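(* Let $(N,\langle\,,\,\rangle)$ be a simply connected $2$-step nilpotent Lie group endowed with a bi-invariant (pseudo-Riemannian) metric. Let $\mathfrak{n}$ be its Lie algebra, $\mathfrak{z}$ the center of $\mathfrak{n}$, and let $\mathfrak{n}=\mathfrak{v}\oplus\mathfrak{z}$ be any direct sum decomposition as vector spaces, with associated splitting $TN=\mathfrak{v}N\oplus\mathfrak{z}N$. Then the center is degenerate and \begin{itemize} \item $\mathrm{Iso}^{spl}(N)\neq\mathrm{Iso}^{aut}(N)$; \item $\mathrm{Iso}^{spl}(N)\subsetneq\mathrm{Iso}(N)$ and $\mathrm{Iso}^{aut}(N)\subsetneq\mathrm{Iso}(N)$. \end{itemize}
   Context: A $2$-step nilpotent Lie group is non-abelian. A metric is bi-invariant if both left- and right-translations are isometries. The center is degenerate if the restriction to $\mathfrak{z}$ of the induced bilinear form on $\mathfrak{n}$ is degenerate. The complement $\mathfrak{v}$ of $\mathfrak{z}$ need not be $\mathfrak{z}^{\perp}$; $\mathfrak{v}N$ and $\mathfrak{z}N$ are the left-invariant distributions obtained by left-translating $\mathfrak{v}$ and $\mathfrak{z}$. $\mathrm{Iso}(N)$ is the full isometry group; $\mathrm{Iso}^{spl}(N)$ is the group of isometries whose differential preserves both $\mathfrak{v}N$ and $\mathfrak{z}N$. $H^{aut_N}=\mathrm{Aut}(N)\cap\mathrm{Iso}(N)$ is the group of isometric automorphisms, and $\mathrm{Iso}^{aut}(N)=N\cdot H^{aut_N}$ is the group of isometries of the form $L_n\circ\varphi$ with $L_n$ the left-translation by $n\in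 N$ and $\varphi\in H^{aut_N}$. *)

theory Defs
  imports
    "HOL-Analysis.Analysis"
    "HOL-Algebra.Group"
    "HOL-Library.Function_Algebras"
begin

section \<open>Real-valued functions as a real vector space\<close>

text \<open>
  Tangent vectors are operators on functions. Their linear structure is the pointwise one, so that
  \<^const>\<open>subspace\<close> applies to sets of tangent vectors.
\<close>

instantiation "fun" :: (type, real_vector) real_vector
begin

definition scaleR_fun :: "real \<Rightarrow> ('a \<Rightarrow> 'b) \<Rightarrow> 'a \<Rightarrow> 'b" where
  "scaleR_fun r f = (\<lambda>x. r *\<^sub>R f x)"

instance
  by standard (auto simp: scaleR_fun_def fun_eq_iff scaleR_add_right scaleR_add_left)

end


section \<open>Smooth maps between open subsets of Euclidean spaces\<close>

text \<open>\<open>C_diff k f S\<close>, \<open>f\<close> is of class \<open>C\<^sup>k\<close> on \<open>S\<close>, is meant for open \<open>S\<close> only.\<close>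

primrec C_diff :: "nat \<Rightarrow> ('a::euclidean_space \<Rightarrow> 'b::euclidean_space) \<Rightarrow> 'a set \<Rightarrow> bool" where
  "C_diff 0 f S \<longleftrightarrow> continuous_on S f"
| "C_diff (Suc k) f S \<longleftrightarrow>
     f differentiable_on S \<and> (\<forall>v. C_diff k (\<lambda>x. frechet_derivative f (at x) v) S)"

definition smooth_on :: "'a set \<Rightarrow> ('a::euclidean_space \<Rightarrow> 'b::euclidean_space) \<Rightarrow> bool" where
  "smooth_on S f \<longleftrightarrow> (\<forall>k. C_diff k f S)"


section \<open>Smooth manifolds\<close>

text \<open>
  A manifold is a whole (Hausdorff, second countable) type with an atlas of charts
  \<open>\<phi> : U \<rightarrow> 'e\<close>. The model space \<open>'e\<close> is an arbitrary finite-dimensional Euclidean space, and the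
  atlas need not be maximal.
\<close>

type_synonym ('m, 'e) atlas = "('m set \<times> ('m \<Rightarrow> 'e)) set"

definition smooth_atlas ::
  "('m::{t2_space,second_countable_topology}, 'e::euclidean_space) atlas \<Rightarrow> bool" where
  "smooth_atlas A \<longleftrightarrow>
     (\<Union>(U, \<phi>)\<in>A. U) = UNIV \<and>
     (\<forall>(U, \<phi>)\<in>A. open U \<and> open (\<phi> ` U) \<and> homeomorphism U (\<phi> ` U) \<phi> (inv_into U \<phi>)) \<and>
     (\<forall>(U, \<phi>)\<in>A. \<forall>(V, \<psi>)\<in>A. smooth_on (\<phi> ` (U \<inter> V)) (\<psi> \<circ> inv_into U \<phi>))"

definition eucl_atlas :: "('e::euclidean_space, 'e) atlas" where
  "eucl_atlas = {(UNIV, \<lambda>x. x)}"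

definition prod_atlas :: "('m, 'e) atlas \<Rightarrow> ('n, 'f) atlas \<Rightarrow> ('m \<times> 'n, 'e \<times> 'f) atlas" where
  "prod_atlas A B = {(U \<times> V, map_prod \<phi> \<psi>) | U \<phi> V \<psi>. (U, \<phi>) \<in> A \<and> (V, \<psi>) \<in> B}"

text \<open>Smoothness of \<open>F\<close> on an open set \<open>W\<close>.\<close>

definition smooth_map_on ::
  "('m::topological_space, 'e::euclidean_space) atlas \<Rightarrow>
   ('n::topological_space, 'f::euclidean_space) atlas \<Rightarrow> 'm set \<Rightarrow> ('m \<Rightarrow> 'n) \<Rightarrow> bool" where
  "smooth_map_on A B W F \<longleftrightarrow>
     continuous_on W F \<and>
     (\<forall>(U, \<phi>)\<in>A. \<forall>(V, \<psi>)\<in>B.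
        smooth_on (\<phi> ` (U \<inter> W \<inter> F -` V)) (\<psi> \<circ> F \<circ> inv_into U \<phi>))"

definition diffeomorphism ::
  "('m::topological_space, 'e::euclidean_space) atlas \<Rightarrow> ('m \<Rightarrow> 'm) \<Rightarrow> bool" where
  "diffeomorphism A F \<longleftrightarrow>
     bij F \<and> smooth_map_on A A UNIV F \<and> smooth_map_on A A UNIV (inv_into UNIV F)"

definition smooth_at ::
  "('m::topological_space, 'e::euclidean_space) atlas \<Rightarrow> 'm \<Rightarrow> ('m \<Rightarrow> real) \<Rightarrow> bool" where
  "smooth_at A p f \<longleftrightarrow> (\<exists>W. open W \<and> p \<in> W \<and> smooth_map_on A eucl_atlas W f)"


section \<open>Tangent vectors and vector fields\<close>

text \<open>
  A tangent vector at \<open>p\<close> is the velocity of a smooth curve \<open>c\<close> through \<open>p\<close>, that is, the operator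
  \<open>f \<mapsto> (f \<circ> c)'(0)\<close> on the functions \<open>f\<close> that are smooth near \<open>p\<close>. On all other functions the
  operators take the value 0, so that equality of tangent vectors is equality of operators.
\<close>

type_synonym 'm tangent_vector = "('m \<Rightarrow> real) \<Rightarrow> real"

definition velocity ::
  "('m::topological_space, 'e::euclidean_space) atlas \<Rightarrow> (real \<Rightarrow> 'm) \<Rightarrow> 'm tangent_vector" where
  "velocity A c = (\<lambda>f. if smooth_at A (c 0) f then deriv (f \<circ> c) 0 else 0)"

definition tangent_space ::
  "('m::topological_space, 'e::euclidean_space) atlas \<Rightarrow> 'm \<Rightarrow> 'm tangent_vector set" where
  "tangent_space A p =
     {velocity A c | c. c 0 = p \<and> (\<exists>\<epsilon>>0. smooth_map_on eucl_atlas A {-\<epsilon><..<\<epsilon>} c)}"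

definition differential ::
  "('m::topological_space, 'e::euclidean_space) atlas \<Rightarrow> ('m \<Rightarrow> 'm) \<Rightarrow> 'm \<Rightarrow>
   'm tangent_vector \<Rightarrow> 'm tangent_vector" where
  "differential A F p X = (\<lambda>f. if smooth_at A (F p) f then X (f \<circ> F) else 0)"

definition smooth_vector_field_on ::
  "('m::topological_space, 'e::euclidean_space) atlas \<Rightarrow> 'm set \<Rightarrow>
   ('m \<Rightarrow> 'm tangent_vector) \<Rightarrow> bool" where
  "smooth_vector_field_on A U X \<longleftrightarrow>
     (\<forall>p\<in>U. X p \<in> tangent_space A p) \<and>
     (\<forall>W f. open W \<and> smooth_map_on A eucl_atlas W f \<longrightarrow>
        smooth_map_on A eucl_atlas (U \<inter> W) (\<lambda>p. X p f))"

definition vf_bracket ::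
  "('m::topological_space, 'e::euclidean_space) atlas \<Rightarrow> ('m \<Rightarrow> 'm tangent_vector) \<Rightarrow>
   ('m \<Rightarrow> 'm tangent_vector) \<Rightarrow> 'm \<Rightarrow> 'm tangent_vector" where
  "vf_bracket A X Y p =
     (\<lambda>f. if smooth_at A p f then X p (\<lambda>q. Y q f) - Y p (\<lambda>q. X q f) else 0)"


section \<open>Pseudo-Riemannian metrics and isometries\<close>

type_synonym 'm metric_tensor = "'m \<Rightarrow> 'm tangent_vector \<Rightarrow> 'm tangent_vector \<Rightarrow> real"

text \<open>The values of \<open>g p\<close> outside the tangent space at \<open>p\<close> are irrelevant.\<close>

definition pseudo_riemannian_metric ::
  "('m::topological_space, 'e::euclidean_space) atlas \<Rightarrow> 'm metric_tensor \<Rightarrow> bool" where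
  "pseudo_riemannian_metric A g \<longleftrightarrow>
     (\<forall>p. \<forall>X\<in>tangent_space A p. \<forall>Y\<in>tangent_space A p. g p X Y = g p Y X) \<and>
     (\<forall>p. \<forall>X\<in>tangent_space A p. \<forall>Y\<in>tangent_space A p. \<forall>Z\<in>tangent_space A p. \<forall>a b.
        g p (a *\<^sub>R X + b *\<^sub>R Y) Z = a * g p X Z + b * g p Y Z) \<and>
     (\<forall>p. \<forall>X\<in>tangent_space A p. (\<forall>Y\<in>tangent_space A p. g p X Y = 0) \<longrightarrow> X = 0) \<and>
     (\<forall>U X Y. open U \<and> smooth_vector_field_on A U X \<and> smooth_vector_field_on A U Y \<longrightarrow>
        smooth_map_on A eucl_atlas U (\<lambda>p. g p (X p) (Y p)))"

definition Iso ::
  "('m::topological_space, 'e::euclidean_space) atlas \<Rightarrow> 'm metric_tensor \<Rightarrow> ('m \<Rightarrow> 'm) set" where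
  "Iso A g =
     {F. diffeomorphism A F \<and>
         (\<forall>p. \<forall>X\<in>tangent_space A p. \<forall>Y\<in>tangent_space A p.
            g (F p) (differential A F p X) (differential A F p Y) = g p X Y)}"


section \<open>Lie groups and their Lie algebras\<close>

definition lie_group ::
  "'n::{t2_space,second_countable_topology} monoid \<Rightarrow> ('n, 'e::euclidean_space) atlas \<Rightarrow> bool" where
  "lie_group G A \<longleftrightarrow>
     group G \<and> carrier G = UNIV \<and> smooth_atlas A \<and>
     smooth_map_on (prod_atlas A A) A UNIV (\<lambda>(x, y). x \<otimes>\<^bsub>G\<^esub> y) \<and>
     smooth_map_on A A UNIV (\<lambda>x. m_inv G x)"

definition left_translation :: "'n monoid \<Rightarrow> 'n \<Rightarrow> 'n \<Rightarrow> 'n" where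
  "left_translation G a = (\<lambda>x. a \<otimes>\<^bsub>G\<^esub> x)"

definition right_translation :: "'n monoid \<Rightarrow> 'n \<Rightarrow> 'n \<Rightarrow> 'n" where
  "right_translation G a = (\<lambda>x. x \<otimes>\<^bsub>G\<^esub> a)"

definition lie_algebra ::
  "'n::topological_space monoid \<Rightarrow> ('n, 'e::euclidean_space) atlas \<Rightarrow> 'n tangent_vector set" where
  "lie_algebra G A = tangent_space A \<one>\<^bsub>G\<^esub>"

definition left_invariant_field ::
  "'n::topological_space monoid \<Rightarrow> ('n, 'e::euclidean_space) atlas \<Rightarrow> 'n tangent_vector \<Rightarrow>
   'n \<Rightarrow> 'n tangent_vector" where
  "left_invariant_field G A X p = differential A (left_translation G p) \<one>\<^bsub>G\<^esub> X"

definition lie_bracket ::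
  "'n::topological_space monoid \<Rightarrow> ('n, 'e::euclidean_space) atlas \<Rightarrow>
   'n tangent_vector \<Rightarrow> 'n tangent_vector \<Rightarrow> 'n tangent_vector" where
  "lie_bracket G A X Y =
     vf_bracket A (left_invariant_field G A X) (left_invariant_field G A Y) \<one>\<^bsub>G\<^esub>"

definition lie_center ::
  "'n::topological_space monoid \<Rightarrow> ('n, 'e::euclidean_space) atlas \<Rightarrow> 'n tangent_vector set" where
  "lie_center G A = {Z \<in> lie_algebra G A. \<forall>X\<in>lie_algebra G A. lie_bracket G A Z X = 0}"

text \<open>A Lie group is 2-step nilpotent if its Lie algebra is; abelian groups are excluded.\<close>

definition two_step_nilpotent ::
  "'n::topological_space monoid \<Rightarrow> ('n, 'e::euclidean_space) atlas \<Rightarrow> bool" where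
  "two_step_nilpotent G A \<longleftrightarrow>
     (\<forall>X\<in>lie_algebra G A. \<forall>Y\<in>lie_algebra G A. \<forall>Z\<in>lie_algebra G A.
        lie_bracket G A (lie_bracket G A X Y) Z = 0) \<and>
     (\<exists>X\<in>lie_algebra G A. \<exists>Y\<in>lie_algebra G A. lie_bracket G A X Y \<noteq> 0)"

definition bi_invariant ::
  "'n::topological_space monoid \<Rightarrow> ('n, 'e::euclidean_space) atlas \<Rightarrow> 'n metric_tensor \<Rightarrow> bool" where
  "bi_invariant G A g \<longleftrightarrow>
     (\<forall>a. left_translation G a \<in> Iso A g) \<and> (\<forall>a. right_translation G a \<in> Iso A g)"

definition degenerate_on ::
  "'v::zero set \<Rightarrow> ('v \<Rightarrow> 'v \<Rightarrow> real) \<Rightarrow> bool" where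
  "degenerate_on S b \<longleftrightarrow> (\<exists>X\<in>S. X \<noteq> 0 \<and> (\<forall>Y\<in>S. b X Y = 0))"

definition direct_sum_decomp :: "'v::real_vector set \<Rightarrow> 'v set \<Rightarrow> 'v set \<Rightarrow> bool" where
  "direct_sum_decomp E V W \<longleftrightarrow>
     subspace V \<and> subspace W \<and> V \<inter> W = {0} \<and> E = {X + Y | X Y. X \<in> V \<and> Y \<in> W}"


section \<open>Subgroups of the isometry group\<close>

definition left_distribution ::
  "'n::topological_space monoid \<Rightarrow> ('n, 'e::euclidean_space) atlas \<Rightarrow> 'n tangent_vector set \<Rightarrow>
   'n \<Rightarrow> 'n tangent_vector set" where
  "left_distribution G A V p = (\<lambda>X. left_invariant_field G A X p) ` V"

definition preserves_distribution ::
  "('m::topological_space, 'e::euclidean_space) atlas \<Rightarrow> ('m \<Rightarrow> 'm) \<Rightarrow>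
   ('m \<Rightarrow> 'm tangent_vector set) \<Rightarrow> bool" where
  "preserves_distribution A F D \<longleftrightarrow> (\<forall>p. differential A F p ` D p = D (F p))"

definition Iso_spl ::
  "'n::topological_space monoid \<Rightarrow> ('n, 'e::euclidean_space) atlas \<Rightarrow> 'n metric_tensor \<Rightarrow>
   'n tangent_vector set \<Rightarrow> ('n \<Rightarrow> 'n) set" where
  "Iso_spl G A g V =
     {F \<in> Iso A g. preserves_distribution A F (left_distribution G A V) \<and>
        preserves_distribution A F (left_distribution G A (lie_center G A))}"

definition isometric_automorphisms ::
  "'n::topological_space monoid \<Rightarrow> ('n, 'e::euclidean_space) atlas \<Rightarrow> 'n metric_tensor \<Rightarrow>
   ('n \<Rightarrow> 'n) set" where
  "isometric_automorphisms G A g = iso G G \<inter> Iso A g"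

definition Iso_aut ::
  "'n::topological_space monoid \<Rightarrow> ('n, 'e::euclidean_space) atlas \<Rightarrow> 'n metric_tensor \<Rightarrow>
   ('n \<Rightarrow> 'n) set" where
  "Iso_aut G A g =
     {left_translation G n \<circ> \<phi> | n \<phi>. \<phi> \<in> isometric_automorphisms G A g}"

end

theory Submission
  imports Defs
begin

text \<open>
  In a chart at the identity, with multiplication \<open>\<mu>\<close>, left translations, right translations and
  \<open>Ad\<close> are related by \<open>D\<^sub>1\<mu>(e, u) (Ad u w) = D\<^sub>2\<mu>(u, e) w\<close>. Differentiating in \<open>u\<close> at the identity and
  using the symmetry of second derivatives shows that the derivative of \<open>Ad\<close> is the Lie bracket.

  For a central \<open>Z\<close>, the derivative of \<open>\<langle>Ad u X, Ad u Z\<rangle> = \<langle>X, Z\<rangle>\<close> is \<open>\<langle>[Y, X], Z\<rangle> = 0\<close>; since a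
  nonzero bracket \<open>[Y, X]\<close> is itself central, the center is degenerate. Every right translation
  \<open>R\<^sub>a = L\<^sub>a \<circ> conj (a\<^sup>-\<^sup>1)\<close> lies in \<open>Iso\<^sup>a\<^sup>u\<^sup>t\<close>. If all of them preserved the left-invariant distribution
  \<open>\<vv>N\<close>, then \<open>Ad\<close> would preserve \<open>\<vv>\<close>, hence \<open>[\<nn>, \<vv>] \<subseteq> \<vv> \<inter> \<zz> = 0\<close> and \<open>\<nn>\<close> would be abelian.
  Finally, inversion is an isometry fixing the identity, but it is not an automorphism.
\<close>

section \<open>Smooth maps between Euclidean spaces\<close>

text \<open>No exponential map is used: \<open>Ad\<close> is differentiated directly along the
  coordinate of the group element. The obstacle is that tangent vectors are operators on functions
  and the Lie bracket is a commutator of such operators, so both have to be turned into calculus on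
  \<open>'e\<close>. One chart at the identity suffices, since conjugations and inversion fix the
  identity and translations carry other points to it. Symmetry of second derivatives enters twice:
  for a test function, to cancel the second-order terms of the commutator, and for the
  multiplication, to identify the derivative of the right translations with that of the left
  translations, arguments exchanged. Inversion is an isometry because its differential at the
  identity is \<open>-1\<close>, which a bilinear form does not see, and bi-invariance transports
  this to every point. It is not an automorphism because that would make the group commutative and
  \<open>Ad\<close> constant, so that all brackets vanish.\<close>

lemma C_diff_cong:
  assumes "open S" "\<And>x. x \<in> S \<Longrightarrow> f x = g x" "C_diff k f S"
  shows "C_diff k g S"
  using assms(2,3)
proof (induction k arbitrary: f g)
  case 0
  then show ?case using continuous_on_eq[of S f g] by simp
next
  case (Suc k)
  have d: "f differentiable at x" if "x \<in> S" for x
    using Suc.prems(2) that by (simp add: differentiable_on_def at_within_open[OF _ assms(1)])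
  \<comment> \<open>A derivative at \<open>x\<close> sees a whole neighbourhood; openness of
    \<open>S\<close> is what lets agreement on \<open>S\<close> reach it.\<close>
  have eq: "frechet_derivative f (at x) = frechet_derivative g (at x)" if "x \<in> S" for x
    using frechet_derivative_transform_within_open[OF d[OF that] assms(1) that] Suc.prems(1) by simp
  have "g differentiable at x" if "x \<in> S" for x
  proof -
    note d[OF that]
    then obtain D where "(f has_derivative D) (at x)"
      by (auto simp: differentiable_def)
    then have "(g has_derivative D) (at x)"
      using Suc.prems(1) by (rule has_derivative_transform_within_open[OF _ assms(1) that])
    then show ?thesis by (auto simp: differentiable_def)
  qed
  moreover have "C_diff k (\<lambda>x. frechet_derivative g (at x) v) S" for v
    using Suc.IH[of "\<lambda>x. frechet_derivative f (at x) v" "\<lambda>x. frechet_derivative g (at x) v"]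
      Suc.prems(2) eq by simp
  ultimately show ?case by (simp add: differentiable_on_def at_within_open[OF _ assms(1)])
qed

text \<open>Uniqueness of derivatives allows an explicit formula \<open>f'\<close> in place of the
  choice operator \<open>frechet_derivative\<close>. The product and chain rules below enter the
  induction in this form.\<close>

lemma C_diff_SucI:
  assumes "open S" "\<And>x. x \<in> S \<Longrightarrow> (f has_derivative f' x) (at x)"
    "\<And>v. C_diff k (\<lambda>x. f' x v) S"
  shows "C_diff (Suc k) f S"
proof -
  have "C_diff k (\<lambda>x. frechet_derivative f (at x) v) S" for v
  proof (rule C_diff_cong[OF assms(1) _ assms(3)[of v]])
    show "f' x v = frechet_derivative f (at x) v" if "x \<in> S" for x
      by (simp add: frechet_derivative_at[OF assms(2)[OF that], symmetric])
  qed
  then show ?thesis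
    using assms(2) by (auto simp: differentiable_on_def differentiable_def at_within_open[OF _ assms(1)])
qed

lemma C_diff_SucD:
  assumes "open S" "C_diff (Suc k) f S" "x \<in> S"
  shows "(f has_derivative frechet_derivative f (at x)) (at x)"
  using assms by (simp add: differentiable_on_def at_within_open[OF _ assms(1)] frechet_derivative_works[symmetric])

lemma C_diff_lower:
  assumes "open S" "C_diff (Suc k) f S"
  shows "C_diff k f S"
  using assms(2)
proof (induction k arbitrary: f)
  case 0
  then show ?case by (simp add: differentiable_imp_continuous_on)
next
  case (Suc k)
  then have "f differentiable_on S" "\<And>v. C_diff (Suc k) (\<lambda>x. frechet_derivative f (at x) v) S"
    by simp_all
  then show ?case using Suc.IH by simp
qed

text \<open>Derivatives are local, so the neighbourhood may vary with the point. This is what makes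
  one pair of charts per point enough in \<open>smooth_map_on_localI\<close>.\<close>

lemma C_diff_local:
  assumes "open S" "\<And>x. x \<in> S \<Longrightarrow> \<exists>T. open T \<and> x \<in> T \<and> C_diff k f T"
  shows "C_diff k f S"
  using assms(2)
proof (induction k arbitrary: f)
  case 0
  then have "isCont f x" if "x \<in> S" for x
    using 0[OF that] by (auto simp: continuous_on_eq_continuous_at)
  then show ?case by (simp add: continuous_at_imp_continuous_on)
next
  case (Suc k)
  show ?case
  proof (rule C_diff_SucI[OF assms(1)])
    show "(f has_derivative frechet_derivative f (at x)) (at x)" if "x \<in> S" for x
    proof -
      note Suc.prems[OF that]
      then obtain T where T: "open T" "x \<in> T" "C_diff (Suc k) f T" by blast
      show ?thesis by (rule C_diff_SucD[OF T(1,3,2)])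
    qed
    show "C_diff k (\<lambda>x. frechet_derivative f (at x) v) S" for v
    proof (rule Suc.IH)
      fix x assume "x \<in> S"
      then obtain T where "open T" "x \<in> T" "C_diff (Suc k) f T" using Suc.prems by blast
      then show "\<exists>T. open T \<and> x \<in> T \<and> C_diff k (\<lambda>x. frechet_derivative f (at x) v) T"
        by (intro exI[of _ T]) simp
    qed
  qed
qed

lemma C_diff_const: "open S \<Longrightarrow> C_diff k (\<lambda>x. c) S"
  by (induction k arbitrary: c) (auto simp: continuous_on_const)

lemma C_diff_bounded_linear_compose:
  assumes "open S" "bounded_linear L" "C_diff k f S"
  shows "C_diff k (\<lambda>x. L (f x)) S"
  using assms(3)
proof (induction k arbitrary: f)
  case 0
  then show ?case using assms(2) by (simp add: bounded_linear.continuous_on)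
next
  case (Suc k)
  show ?case
  proof (rule C_diff_SucI[OF assms(1)])
    show "((\<lambda>x. L (f x)) has_derivative (\<lambda>v. L (frechet_derivative f (at x) v))) (at x)"
      if "x \<in> S" for x
      using bounded_linear.has_derivative[OF assms(2) C_diff_SucD[OF assms(1) Suc.prems that]] .
    show "C_diff k (\<lambda>x. L (frechet_derivative f (at x) v)) S" for v
      by (rule Suc.IH) (use Suc.prems in simp)
  qed
qed

lemma C_diff_ident: "open S \<Longrightarrow> C_diff k (\<lambda>x. x) S"
  by (cases k) (auto intro: C_diff_const simp: continuous_on_id)

lemma C_diff_bounded_linear: "open S \<Longrightarrow> bounded_linear L \<Longrightarrow> C_diff k L S"
  using C_diff_bounded_linear_compose[OF _ _ C_diff_ident] by blast

lemma C_diff_add: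
  assumes "open S" "C_diff k f S" "C_diff k g S"
  shows "C_diff k (\<lambda>x. f x + g x) S"
  using assms(2,3)
proof (induction k arbitrary: f g)
  case 0
  then show ?case by (simp add: continuous_on_add)
next
  case (Suc k)
  show ?case
  proof (rule C_diff_SucI[OF assms(1)])
    show "((\<lambda>x. f x + g x) has_derivative
        (\<lambda>v. frechet_derivative f (at x) v + frechet_derivative g (at x) v)) (at x)"
      if "x \<in> S" for x
      using C_diff_SucD[OF assms(1) Suc.prems(1) that] C_diff_SucD[OF assms(1) Suc.prems(2) that]
      by (rule has_derivative_add)
    show "C_diff k (\<lambda>x. frechet_derivative f (at x) v + frechet_derivative g (at x) v) S" for v
      by (rule Suc.IH) (use Suc.prems in simp_all)
  qed
qed

lemma C_diff_sum:
  assumes "open S" "finite I" "\<And>i. i \<in> I \<Longrightarrow> C_diff k (f i) S"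
  shows "C_diff k (\<lambda>x. \<Sum>i\<in>I. f i x) S"
  using assms(2,3) by (induction I) (auto intro: C_diff_const C_diff_add assms(1))

lemma C_diff_scaleR:
  assumes "open S" "C_diff k a S" "C_diff k f S"
  shows "C_diff k (\<lambda>x. a x *\<^sub>R f x) S"
  using assms(2,3)
proof (induction k arbitrary: a f)
  case 0
  then show ?case by (simp add: continuous_on_scaleR)
next
  case (Suc k)
  show ?case
  proof (rule C_diff_SucI[OF assms(1)])
    show "((\<lambda>x. a x *\<^sub>R f x) has_derivative
        (\<lambda>v. a x *\<^sub>R frechet_derivative f (at x) v + frechet_derivative a (at x) v *\<^sub>R f x)) (at x)"
      if "x \<in> S" for x
      using C_diff_SucD[OF assms(1) Suc.prems(1) that] C_diff_SucD[OF assms(1) Suc.prems(2) that]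
      by (rule has_derivative_scaleR)
    \<comment> \<open>The product rule leaves one factor undifferentiated, so the induction
      hypothesis needs that factor at the lower order \<open>k\<close>.\<close>
    show "C_diff k (\<lambda>x. a x *\<^sub>R frechet_derivative f (at x) v +
        frechet_derivative a (at x) v *\<^sub>R f x) S" for v
      using Suc.prems C_diff_lower[OF assms(1) Suc.prems(1)] C_diff_lower[OF assms(1) Suc.prems(2)]
      by (intro C_diff_add assms(1) Suc.IH) auto
  qed
qed

lemma C_diff_compose:
  assumes "open S" "open T" "C_diff k f S" "C_diff k g T" "f ` S \<subseteq> T"
  shows "C_diff k (\<lambda>x. g (f x)) S"
  using assms(3,4,5)
proof (induction k arbitrary: f g)
  case 0
  then show ?case by (auto intro: continuous_on_compose2)
next
  case (Suc k)
  let ?f = "\<lambda>x. frechet_derivative f (at x)" and ?g = "\<lambda>y. frechet_derivative g (at y)"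
  have df: "(f has_derivative ?f x) (at x)" if "x \<in> S" for x
    using C_diff_SucD[OF assms(1) Suc.prems(1) that] .
  have dg: "(g has_derivative ?g (f x)) (at (f x))" if "x \<in> S" for x
    using C_diff_SucD[OF assms(2) Suc.prems(2)] Suc.prems(3) that by blast
  show ?case
  proof (rule C_diff_SucI[OF assms(1)])
    show "((\<lambda>x. g (f x)) has_derivative (\<lambda>v. ?g (f x) (?f x v))) (at x)" if "x \<in> S" for x
      using has_derivative_compose[OF df[OF that] dg[OF that]] .
    fix v
    \<comment> \<open>Point and direction of the derivative of \<open>g\<close> both vary with
      \<open>x\<close>. Expanding the direction in the basis separates them: only
      \<open>?g (f x) b\<close> with fixed \<open>b\<close> remains, and the induction hypothesis
      applies to it.\<close>
    have *: "(\<Sum>b\<in>Basis. (?f x v \<bullet> b) *\<^sub>R ?g (f x) b) = ?g (f x) (?f x v)" if "x \<in> S" for x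
    proof -
      interpret l: linear "?g (f x)"
        using dg[OF that] has_derivative_linear by blast
      have "?g (f x) (?f x v) = ?g (f x) (\<Sum>b\<in>Basis. (?f x v \<bullet> b) *\<^sub>R b)"
        by (simp add: euclidean_representation)
      then show ?thesis by (simp add: l.sum l.scale)
    qed
    have "C_diff k (\<lambda>x. \<Sum>b\<in>Basis. (?f x v \<bullet> b) *\<^sub>R ?g (f x) b) S"
    proof (intro C_diff_sum C_diff_scaleR assms(1) finite_Basis)
      show "C_diff k (\<lambda>x. ?f x v \<bullet> b) S" for b
        by (rule C_diff_bounded_linear_compose[OF assms(1) bounded_linear_inner_left])
          (use Suc.prems(1) in simp)
      show "C_diff k (\<lambda>x. ?g (f x) b) S" for b
        using Suc.IH[OF C_diff_lower[OF assms(1) Suc.prems(1)], of "\<lambda>y. ?g y b"] Suc.prems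
        by simp
    qed
    then show "C_diff k (\<lambda>x. ?g (f x) (?f x v)) S"
      by (rule C_diff_cong[OF assms(1), rotated]) (rule *)
  qed
qed

lemma C_diff_Pair:
  assumes "open S" "C_diff k f S" "C_diff k g S"
  shows "C_diff k (\<lambda>x. (f x, g x)) S"
proof -
  have "C_diff k (\<lambda>x. (f x, 0) + (0, g x)) S"
    by (intro C_diff_add C_diff_bounded_linear_compose[OF assms(1) _ assms(2), of "\<lambda>y. (y, 0)"]
        C_diff_bounded_linear_compose[OF assms(1) _ assms(3), of "\<lambda>y. (0, y)"] assms(1)
        bounded_linear_Pair bounded_linear_ident bounded_linear_zero)
  then show ?thesis by simp
qed

lemma smooth_on_cong:
  "open S \<Longrightarrow> smooth_on S f \<Longrightarrow> (\<And>x. x \<in> S \<Longrightarrow> f x = g x) \<Longrightarrow> smooth_on S g"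
  unfolding smooth_on_def by (auto intro: C_diff_cong)

lemma smooth_on_local:
  assumes "open S" "\<And>x. x \<in> S \<Longrightarrow> \<exists>T. open T \<and> x \<in> T \<and> smooth_on T f"
  shows "smooth_on S f"
proof -
  have "C_diff k f S" for k
    by (rule C_diff_local[OF assms(1)]) (use assms(2) in \<open>auto simp: smooth_on_def\<close>)
  then show ?thesis by (simp add: smooth_on_def)
qed

lemma smooth_on_subset: "smooth_on S f \<Longrightarrow> open S \<Longrightarrow> open T \<Longrightarrow> T \<subseteq> S \<Longrightarrow> smooth_on T f"
  by (rule smooth_on_local) auto

lemma smooth_on_compose:
  "smooth_on S f \<Longrightarrow> smooth_on T g \<Longrightarrow> open S \<Longrightarrow> open T \<Longrightarrow> f ` S \<subseteq> T \<Longrightarrow>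
    smooth_on S (\<lambda>x. g (f x))"
  unfolding smooth_on_def using C_diff_compose by blast

lemma smooth_on_const: "open S \<Longrightarrow> smooth_on S (\<lambda>x. c)"
  by (simp add: smooth_on_def C_diff_const)

lemma smooth_on_bounded_linear: "open S \<Longrightarrow> bounded_linear L \<Longrightarrow> smooth_on S L"
  by (simp add: smooth_on_def C_diff_bounded_linear)

lemma smooth_on_ident: "open S \<Longrightarrow> smooth_on S (\<lambda>x. x)"
  by (simp add: smooth_on_def C_diff_ident)

lemma smooth_on_add:
  "open S \<Longrightarrow> smooth_on S f \<Longrightarrow> smooth_on S g \<Longrightarrow> smooth_on S (\<lambda>x. f x + g x)"
  by (simp add: smooth_on_def C_diff_add)

lemma smooth_on_Pair:
  "open S \<Longrightarrow> smooth_on S f \<Longrightarrow> smooth_on S g \<Longrightarrow> smooth_on S (\<lambda>x. (f x, g x))"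
  by (simp add: smooth_on_def C_diff_Pair)

lemma smooth_on_imp_has_derivative:
  "smooth_on S f \<Longrightarrow> open S \<Longrightarrow> x \<in> S \<Longrightarrow> (f has_derivative frechet_derivative f (at x)) (at x)"
  unfolding smooth_on_def by (rule C_diff_SucD[where k = 0]) auto

lemma smooth_on_imp_continuous_on: "smooth_on S f \<Longrightarrow> continuous_on S f"
  unfolding smooth_on_def by (auto dest: spec[of _ 0])

lemma smooth_on_frechet_derivative:
  "smooth_on S f \<Longrightarrow> smooth_on S (\<lambda>x. frechet_derivative f (at x) v)"
  
proof -
  assume "smooth_on S f"
  then have "C_diff (Suc k) f S" for k by (simp only: smooth_on_def)
  then show ?thesis by (simp add: smooth_on_def)
qed

lemma smooth_on_imp_linear:
  "smooth_on S f \<Longrightarrow> open S \<Longrightarrow> x \<in> S \<Longrightarrow> linear (frechet_derivative f (at x))"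
  using smooth_on_imp_has_derivative has_derivative_linear by blast

section \<open>Symmetry of second derivatives\<close>

lemma second_difference_mvt:
  fixes f :: "'a::euclidean_space \<Rightarrow> real"
  assumes sm: "smooth_on (ball x \<epsilon>) f" and r: "0 < r" "r * (norm h + norm k) < \<epsilon>"
  shows "\<exists>z. norm (z - x) \<le> r * (norm h + norm k) \<and>
    f (x + r *\<^sub>R h + r *\<^sub>R k) - f (x + r *\<^sub>R h) - f (x + r *\<^sub>R k) + f x =
      r * r * frechet_derivative (\<lambda>y. frechet_derivative f (at y) h) (at z) k"
proof -
  let ?D = "\<lambda>y. frechet_derivative f (at y) h"
  \<comment> \<open>Derivatives are taken only at points of the parallelogram spanned by
    \<open>r *\<^sub>R h\<close> and \<open>r *\<^sub>R k\<close>, which stays inside the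
    ball.\<close>
  have inb: "x + s *\<^sub>R h + t *\<^sub>R k \<in> ball x \<epsilon> \<and>
      norm ((x + s *\<^sub>R h + t *\<^sub>R k) - x) \<le> r * (norm h + norm k)"
    if "0 \<le> s" "s \<le> r" "0 \<le> t" "t \<le> r" for s t
  proof -
    have "norm (s *\<^sub>R h + t *\<^sub>R k) \<le> s * norm h + t * norm k"
      using norm_triangle_ineq[of "s *\<^sub>R h" "t *\<^sub>R k"] that by simp
    also have "\<dots> \<le> r * norm h + r * norm k"
      using that by (intro add_mono mult_right_mono) auto
    finally have *: "norm (s *\<^sub>R h + t *\<^sub>R k) \<le> r * (norm h + norm k)" by (simp add: distrib_left)
    moreover have "dist x (x + s *\<^sub>R h + t *\<^sub>R k) = norm (s *\<^sub>R h + t *\<^sub>R k)"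
      by (metis add.assoc add_diff_cancel_left' dist_commute dist_norm)
    ultimately show ?thesis using r(2) by (simp add: add.assoc)
  qed
  have dF: "((\<lambda>s. f (x + s *\<^sub>R h + t *\<^sub>R k)) has_real_derivative ?D (x + s *\<^sub>R h + t *\<^sub>R k)) (at s)"
    if "0 \<le> s" "s \<le> r" "0 \<le> t" "t \<le> r" for s t
  proof -
    let ?y = "x + s *\<^sub>R h + t *\<^sub>R k"
    note d = smooth_on_imp_has_derivative[OF sm open_ball, of ?y]
    have "((\<lambda>s. x + s *\<^sub>R h + t *\<^sub>R k) has_derivative (\<lambda>a. a *\<^sub>R h)) (at s)"
      by (auto intro!: derivative_eq_intros)
    from has_derivative_compose[OF this] d
    have "((\<lambda>s. f (x + s *\<^sub>R h + t *\<^sub>R k)) has_derivative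
        (\<lambda>a. frechet_derivative f (at ?y) (a *\<^sub>R h))) (at s)"
      using inb[OF that] by blast
    moreover have "frechet_derivative f (at ?y) (a *\<^sub>R h) = ?D ?y * a" for a
      using smooth_on_imp_linear[OF sm open_ball, of ?y] inb[OF that]
      by (simp add: linear_scale mult.commute)
    ultimately show ?thesis by (simp add: has_field_derivative_def)
  qed
  \<comment> \<open>The second difference is the increment of \<open>q\<close>, the first difference
    along \<open>k\<close>. The mean value theorem along \<open>h\<close> and then along
    \<open>k\<close> produces the mixed derivative with \<open>h\<close> innermost.\<close>
  define q where "q s = f (x + s *\<^sub>R h + r *\<^sub>R k) - f (x + s *\<^sub>R h)" for s
  have "\<exists>s. 0 < s \<and> s < r \<and> q r - q 0 = (r - 0) * (?D (x + s *\<^sub>R h + r *\<^sub>R k) - ?D (x + s *\<^sub>R h))"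
  proof (rule MVT2[OF r(1)])
    fix s assume s: "0 \<le> s" "s \<le> r"
    then show "(q has_real_derivative ?D (x + s *\<^sub>R h + r *\<^sub>R k) - ?D (x + s *\<^sub>R h)) (at s)"
      unfolding q_def using dF[OF s, of r] dF[OF s, of 0] r(1) by (auto intro!: DERIV_diff)
  qed
  then obtain s where s: "0 < s" "s < r"
    "q r - q 0 = r * (?D (x + s *\<^sub>R h + r *\<^sub>R k) - ?D (x + s *\<^sub>R h))" by auto
  note smD = smooth_on_frechet_derivative[OF sm, of h]
  define p where "p t = ?D (x + s *\<^sub>R h + t *\<^sub>R k)" for t
  have "\<exists>t. 0 < t \<and> t < r \<and> p r - p 0 = (r - 0) * frechet_derivative ?D (at (x + s *\<^sub>R h + t *\<^sub>R k)) k"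
  proof (rule MVT2[OF r(1)])
    fix t assume t: "0 \<le> t" "t \<le> r"
    let ?y = "x + s *\<^sub>R h + t *\<^sub>R k"
    have y: "?y \<in> ball x \<epsilon>" using inb[of s t] s t by simp
    have "((\<lambda>t. x + s *\<^sub>R h + t *\<^sub>R k) has_derivative (\<lambda>a. a *\<^sub>R k)) (at t)"
      by (auto intro!: derivative_eq_intros)
    from has_derivative_compose[OF this smooth_on_imp_has_derivative[OF smD open_ball y]]
    have "(p has_derivative (\<lambda>a. frechet_derivative ?D (at ?y) (a *\<^sub>R k))) (at t)"
      by (simp add: p_def[abs_def])
    moreover have "frechet_derivative ?D (at ?y) (a *\<^sub>R k) = frechet_derivative ?D (at ?y) k * a" for a
      using smooth_on_imp_linear[OF smD open_ball y] by (simp add: linear_scale mult.commute)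
    ultimately show "(p has_real_derivative frechet_derivative ?D (at ?y) k) (at t)"
      by (simp add: has_field_derivative_def)
  qed
  then obtain t where t: "0 < t" "t < r"
    "p r - p 0 = r * frechet_derivative ?D (at (x + s *\<^sub>R h + t *\<^sub>R k)) k" by auto
  show ?thesis
  proof (intro exI conjI)
    show "norm (x + s *\<^sub>R h + t *\<^sub>R k - x) \<le> r * (norm h + norm k)"
      using inb[of s t] s t by simp
    have "f (x + r *\<^sub>R h + r *\<^sub>R k) - f (x + r *\<^sub>R h) - f (x + r *\<^sub>R k) + f x = q r - q 0"
      by (simp add: q_def)
    also have "\<dots> = r * (p r - p 0)" using s(3) by (simp add: p_def)
    finally show "f (x + r *\<^sub>R h + r *\<^sub>R k) - f (x + r *\<^sub>R h) - f (x + r *\<^sub>R k) + f x =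
      r * r * frechet_derivative ?D (at (x + s *\<^sub>R h + t *\<^sub>R k)) k"
      using t(3) by simp
  qed
qed

text \<open>The second difference does not change when \<open>h\<close> and \<open>k\<close> are
  exchanged, so \<open>second_difference_mvt\<close> gives the two mixed derivatives equal values at
  points that shrink to \<open>x\<close>; continuity finishes.\<close>

lemma second_derivative_symmetric_real:
  fixes f :: "'a::euclidean_space \<Rightarrow> real"
  assumes "open S" "x \<in> S" "smooth_on S f"
  shows "frechet_derivative (\<lambda>y. frechet_derivative f (at y) h) (at x) k =
    frechet_derivative (\<lambda>y. frechet_derivative f (at y) k) (at x) h"
    (is "?H x = ?K x")
proof -
  obtain \<epsilon> where e: "\<epsilon> > 0" "ball x \<epsilon> \<subseteq> S" using assms(1,2) openE by blast
  have sm: "smooth_on (ball x \<epsilon>) f" using smooth_on_subset[OF assms(3,1)] e by simp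
  define c where "c = norm h + norm k"
  have c0: "c \<ge> 0" by (simp add: c_def)
  \<comment> \<open>The \<open>c + 1\<close> keeps the denominator positive even if \<open>h\<close>
    and \<open>k\<close> vanish; the \<open>+ 2\<close> makes the second factor exceed 1 strictly,
    as the proof of \<open>r n * c < \<epsilon>\<close> requires.\<close>
  define r where "r n = \<epsilon> / ((c + 1) * (real n + 2))" for n
  have r0: "r n > 0" for n using e(1) c0 by (simp add: r_def)
  have rc: "r n * c < \<epsilon>" for n
  proof -
    have "c * 1 < (c + 1) * (real n + 2)" using c0 by (intro mult_strict_mono) auto
    then have "c / ((c + 1) * (real n + 2)) < 1" using c0 by simp
    from mult_strict_left_mono[OF this e(1)] show ?thesis by (simp add: r_def)
  qed
  have rlim: "(\<lambda>n. r n * c) \<longlonglongrightarrow> 0"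
  proof -
    have "(\<lambda>n. (\<epsilon> * c / (c + 1)) * (1 / (real n + 2))) \<longlonglongrightarrow> (\<epsilon> * c / (c + 1)) * 0"
      by (intro tendsto_mult tendsto_const tendsto_divide_0[OF tendsto_const] filterlim_at_top_imp_at_infinity
          filterlim_tendsto_add_at_top[OF _ filterlim_real_sequentially, of "\<lambda>_. 2" 2, unfolded add.commute[of 2]])
    then show ?thesis by (simp add: r_def)
  qed
  let ?\<Delta> = "\<lambda>n. f (x + r n *\<^sub>R h + r n *\<^sub>R k) - f (x + r n *\<^sub>R h) - f (x + r n *\<^sub>R k) + f x"
  have "\<exists>z. norm (z - x) \<le> r n * c \<and> ?\<Delta> n = r n * r n * ?H z" for n
    using second_difference_mvt[OF sm r0, of n h k] rc[of n] by (simp add: c_def)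
  then obtain y where y: "\<And>n. norm (y n - x) \<le> r n * c" "\<And>n. ?\<Delta> n = r n * r n * ?H (y n)"
    by metis
  have "\<exists>z. norm (z - x) \<le> r n * c \<and> ?\<Delta> n = r n * r n * ?K z" for n
    using second_difference_mvt[OF sm r0, of n k h] rc[of n]
    by (simp add: c_def algebra_simps)
  then obtain z where z: "\<And>n. norm (z n - x) \<le> r n * c" "\<And>n. ?\<Delta> n = r n * r n * ?K (z n)"
    by metis
  have eq: "?H (y n) = ?K (z n)" for n
    using y(2)[of n] z(2)[of n] r0[of n] by simp
  have lim: "w \<longlonglongrightarrow> x" if "\<And>n. norm (w n - x) \<le> r n * c" for w
    using that rlim by (metis (no_types, lifting) LIM_zero_cancel Lim_null_comparison eventually_sequentiallyI)
  have cont: "isCont ?H x" "isCont ?K x"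
    using smooth_on_imp_continuous_on[OF smooth_on_frechet_derivative[OF smooth_on_frechet_derivative[OF assms(3)]]]
      assms(1,2) continuous_on_eq_continuous_at by blast+
  have "(\<lambda>n. ?H (y n)) \<longlonglongrightarrow> ?H x" "(\<lambda>n. ?K (z n)) \<longlonglongrightarrow> ?K x"
    using isCont_tendsto_compose[OF cont(1) lim[OF y(1)]] isCont_tendsto_compose[OF cont(2) lim[OF z(1)]]
    by auto
  then show ?thesis using eq LIMSEQ_unique by simp
qed

text \<open>Pairing with a basis vector \<open>b\<close> commutes with both differentiations, which
  reduces the claim to real-valued functions.\<close>

lemma second_derivative_symmetric:
  fixes f :: "'a::euclidean_space \<Rightarrow> 'b::euclidean_space"
  assumes "open S" "x \<in> S" "smooth_on S f"
  shows "frechet_derivative (\<lambda>y. frechet_derivative f (at y) h) (at x) k =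
    frechet_derivative (\<lambda>y. frechet_derivative f (at y) k) (at x) h"
proof (rule euclidean_eqI)
  fix b :: 'b
  assume "b \<in> Basis"
  have smb: "smooth_on S (\<lambda>y. f y \<bullet> b)"
    by (rule smooth_on_compose[OF assms(3) smooth_on_bounded_linear[OF open_UNIV bounded_linear_inner_left[of b]]])
      (use assms(1) in auto)
  have 1: "frechet_derivative (\<lambda>y. g y \<bullet> b) (at y) = (\<lambda>v. frechet_derivative g (at y) v \<bullet> b)"
    if "smooth_on S g" "y \<in> S" for g :: "'a \<Rightarrow> 'b" and y
    using bounded_linear.has_derivative[OF bounded_linear_inner_left
        smooth_on_imp_has_derivative[OF that(1) assms(1) that(2)], of b]
    by (rule frechet_derivative_at[symmetric])
  have 2: "frechet_derivative (\<lambda>y. frechet_derivative (\<lambda>y. f y \<bullet> b) (at y) h) (at x) k =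
    frechet_derivative (\<lambda>y. frechet_derivative f (at y) h) (at x) k \<bullet> b" for h k
  proof -
    have "frechet_derivative (\<lambda>y. frechet_derivative (\<lambda>y. f y \<bullet> b) (at y) h) (at x) =
      frechet_derivative (\<lambda>y. frechet_derivative f (at y) h \<bullet> b) (at x)"
      by (rule frechet_derivative_transform_within_open[OF _ assms(1,2)])
        (use 1[OF assms(3)] smooth_on_imp_has_derivative[OF smooth_on_frechet_derivative[OF smb] assms(1,2)]
          in \<open>auto simp: differentiable_def\<close>)
    then show ?thesis using 1[OF smooth_on_frechet_derivative[OF assms(3)] assms(2)] by simp
  qed
  show "frechet_derivative (\<lambda>y. frechet_derivative f (at y) h) (at x) k \<bullet> b =
    frechet_derivative (\<lambda>y. frechet_derivative f (at y) k) (at x) h \<bullet> b"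
    using second_derivative_symmetric_real[OF assms(1,2) smb, of h k] 2 by simp
qed

section \<open>Linear maps depending on a parameter\<close>

lemma has_derivative_linear_family:
  fixes B :: "'a::euclidean_space \<Rightarrow> 'b::euclidean_space \<Rightarrow> 'c::euclidean_space"
  assumes S: "open S" "x \<in> S" and lin: "\<And>u. u \<in> S \<Longrightarrow> linear (B u)"
    and B: "\<And>w. ((\<lambda>u. B u w) has_derivative B' w) (at x)"
    and a: "(a has_derivative a') (at x)"
  shows "((\<lambda>u. B u (a u)) has_derivative (\<lambda>h. B x (a' h) + B' (a x) h)) (at x)"
proof -
  \<comment> \<open>On \<open>S\<close> the linear map is determined by its values on the basis,
    whose derivatives are given; the ordinary product rule then applies term by term.\<close>
  have rep: "(\<Sum>b\<in>Basis. (w \<bullet> b) *\<^sub>R B u b) = B u w" if "u \<in> S" for u w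
  proof -
    interpret linear "B u" using lin[OF that] .
    have "B u w = B u (\<Sum>b\<in>Basis. (w \<bullet> b) *\<^sub>R b)" by (simp add: euclidean_representation)
    then show ?thesis by (simp add: sum scale)
  qed
  have main: "((\<lambda>u. B u (a u)) has_derivative
      (\<lambda>h. \<Sum>b\<in>Basis. (a x \<bullet> b) *\<^sub>R B' b h + (a' h \<bullet> b) *\<^sub>R B x b)) (at x)"
    if a: "(a has_derivative a') (at x)" for a a'
  proof (rule has_derivative_transform_within_open[OF _ S])
    show "((\<lambda>u. \<Sum>b\<in>Basis. (a u \<bullet> b) *\<^sub>R B u b) has_derivative
      (\<lambda>h. \<Sum>b\<in>Basis. (a x \<bullet> b) *\<^sub>R B' b h + (a' h \<bullet> b) *\<^sub>R B x b)) (at x)"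
      by (intro has_derivative_sum has_derivative_scaleR B
          bounded_linear.has_derivative[OF bounded_linear_inner_left] a)
  qed (rule rep)
  \<comment> \<open>How \<open>B'\<close> depends on its vector argument is not given; the case of a
    constant \<open>a\<close> yields its basis expansion at \<open>a x\<close> by uniqueness of
    derivatives.\<close>
  have "B' (a x) = (\<lambda>h. \<Sum>b\<in>Basis. (a x \<bullet> b) *\<^sub>R B' b h)"
    using has_derivative_unique[OF B main[OF has_derivative_const, of "a x"]] by simp
  then have "(\<lambda>h. \<Sum>b\<in>Basis. (a x \<bullet> b) *\<^sub>R B' b h + (a' h \<bullet> b) *\<^sub>R B x b) =
      (\<lambda>h. B x (a' h) + B' (a x) h)"
    using rep[OF S(2)] by (auto simp: sum.distrib add.commute)
  then show ?thesis using main[OF a] by simp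
qed

lemma smooth_on_linear_family:
  fixes B :: "'a::euclidean_space \<Rightarrow> 'b::euclidean_space \<Rightarrow> 'c::euclidean_space"
  assumes S: "open S" and lin: "\<And>u. u \<in> S \<Longrightarrow> linear (B u)"
    and B: "\<And>w. smooth_on S (\<lambda>u. B u w)" and a: "smooth_on S a"
  shows "smooth_on S (\<lambda>u. B u (a u))"
proof -
  have rep: "(\<Sum>b\<in>Basis. (a u \<bullet> b) *\<^sub>R B u b) = B u (a u)" if "u \<in> S" for u
  proof -
    interpret linear "B u" using lin[OF that] .
    have "B u (a u) = B u (\<Sum>b\<in>Basis. (a u \<bullet> b) *\<^sub>R b)" by (simp add: euclidean_representation)
    then show ?thesis by (simp add: sum scale)
  qed
  have "smooth_on S (\<lambda>u. \<Sum>b\<in>Basis. (a u \<bullet> b) *\<^sub>R B u b)"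
    unfolding smooth_on_def
    using B a by (auto intro!: C_diff_sum C_diff_scaleR S
        C_diff_bounded_linear_compose[OF S bounded_linear_inner_left] simp: smooth_on_def)
  then show ?thesis by (rule smooth_on_cong[OF S]) (rule rep)
qed


section \<open>Charts and tangent vectors\<close>

lemma
  assumes "smooth_atlas A" "(U, \<phi>) \<in> A"
  shows chart_open: "open U"
    and chart_range_open: "open (\<phi> ` U)"
    and chart_homeomorphism: "homeomorphism U (\<phi> ` U) \<phi> (inv_into U \<phi>)"
  using assms unfolding smooth_atlas_def by auto

lemma chart_exists: "smooth_atlas A \<Longrightarrow> \<exists>U \<phi>. (U, \<phi>) \<in> A \<and> p \<in> U"
proof -
  assume "smooth_atlas A"
  then have "p \<in> (\<Union>(U, \<phi>)\<in>A. U)" by (simp add: smooth_atlas_def)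
  then show ?thesis by auto
qed

lemma
  assumes "smooth_atlas A" "(U, \<phi>) \<in> A"
  shows chart_continuous: "continuous_on U \<phi>"
    and chart_inverse_continuous: "continuous_on (\<phi> ` U) (inv_into U \<phi>)"
    and chart_inverse_left: "\<And>x. x \<in> U \<Longrightarrow> inv_into U \<phi> (\<phi> x) = x"
  using chart_homeomorphism[OF assms] unfolding homeomorphism_def by auto

lemma chart_inj: "smooth_atlas A \<Longrightarrow> (U, \<phi>) \<in> A \<Longrightarrow> inj_on \<phi> U"
  by (rule inj_on_inverseI) (rule chart_inverse_left)

lemma chart_image_open:
  assumes "smooth_atlas A" "(U, \<phi>) \<in> A" "open W" "W \<subseteq> U"
  shows "open (\<phi> ` W)"
proof -
  have "openin (top_of_set U) W"
    using assms(3,4) by (simp add: chart_open[OF assms(1,2)] openin_open_eq)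
  then have "openin (top_of_set (\<phi> ` U)) (\<phi> ` W)"
    using homeomorphism_imp_open_map[OF chart_homeomorphism[OF assms(1,2)]] by blast
  then show ?thesis
    using chart_range_open[OF assms(1,2)] openin_open_trans by blast
qed

lemma transition_smooth:
  assumes "smooth_atlas A" "(U, \<phi>) \<in> A" "(V, \<psi>) \<in> A"
  shows "smooth_on (\<phi> ` (U \<inter> V)) (\<lambda>x. \<psi> (inv_into U \<phi> x))"
proof -
  have "smooth_on (\<phi> ` (U \<inter> V)) (\<psi> \<circ> inv_into U \<phi>)"
    using assms unfolding smooth_atlas_def by fast
  then show ?thesis by (simp add: o_def)
qed

lemma inv_into_UNIV_ident: "inv_into UNIV (\<lambda>x. x) = (\<lambda>x. x)"
  by (rule ext) (simp add: inv_f_eq)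

lemma smooth_atlas_eucl: "smooth_atlas eucl_atlas"
  by (auto simp: smooth_atlas_def eucl_atlas_def inv_into_UNIV_ident o_def homeomorphism_ident
      intro: smooth_on_ident)

lemma eucl_chart: "(UNIV, \<lambda>x. x) \<in> eucl_atlas"
  by (simp add: eucl_atlas_def)

section \<open>Smoothness of maps tested in charts\<close>

lemma smooth_map_onD:
  assumes "smooth_map_on A B W F" "(U, \<phi>) \<in> A" "(V, \<psi>) \<in> B"
  shows "smooth_on (\<phi> ` (U \<inter> W \<inter> F -` V)) (\<lambda>x. \<psi> (F (inv_into U \<phi> x)))"
proof -
  have "smooth_on (\<phi> ` (U \<inter> W \<inter> F -` V)) (\<psi> \<circ> F \<circ> inv_into U \<phi>)"
    using assms unfolding smooth_map_on_def by fast
  then show ?thesis by (simp add: o_def)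
qed

lemma smooth_map_on_continuous: "smooth_map_on A B W F \<Longrightarrow> continuous_on W F"
  by (simp add: smooth_map_on_def)

lemma open_Int_vimage: "open W \<Longrightarrow> continuous_on W F \<Longrightarrow> open V \<Longrightarrow> open (W \<inter> F -` V)"
  by (metis continuous_on_open_vimage inf_commute)

lemma smooth_map_on_chart_nbhd:
  assumes "smooth_map_on A B W F" "open W" "p \<in> W" "smooth_atlas A" "smooth_atlas B"
    "(U, \<phi>) \<in> A" "p \<in> U" "(V, \<psi>) \<in> B" "F p \<in> V"
  shows "\<exists>W'. open W' \<and> p \<in> W' \<and> W' \<subseteq> U \<and> W' \<subseteq> W \<and> F ` W' \<subseteq> V \<and>
    smooth_on (\<phi> ` W') (\<lambda>x. \<psi> (F (inv_into U \<phi> x)))"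
proof (intro exI conjI)
  have "open (W \<inter> F -` V)"
    using open_Int_vimage assms(1,2) smooth_map_on_continuous chart_open[OF assms(5,8)] by blast
  then show "open (U \<inter> W \<inter> F -` V)"
    using chart_open[OF assms(4,6)] by (simp add: open_Int Int_assoc)
  show "smooth_on (\<phi> ` (U \<inter> W \<inter> F -` V)) (\<lambda>x. \<psi> (F (inv_into U \<phi> x)))"
    using smooth_map_onD[OF assms(1,6,8)] .
qed (use assms in auto)

text \<open>The definition quantifies over all charts, the hypothesis provides one pair near each
  point. The two coordinate expressions differ by a transition map on either side.\<close>

lemma smooth_map_on_localI:
  assumes A: "smooth_atlas A" and B: "smooth_atlas B" and W: "open W"
    and loc: "\<And>p. p \<in> W \<Longrightarrow> \<exists>U \<phi> V \<psi> W'. (U, \<phi>) \<in> A \<and> (V, \<psi>) \<in> B \<and> open W' \<and> p \<in> W' \<and>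
      W' \<subseteq> U \<and> F ` W' \<subseteq> V \<and> smooth_on (\<phi> ` W') (\<lambda>x. \<psi> (F (inv_into U \<phi> x)))"
  shows "smooth_map_on A B W F"
proof -
  \<comment> \<open>Continuity is not part of the hypothesis; it comes from the smooth coordinate
    expression by undoing both charts.\<close>
  have "isCont F p" if "p \<in> W" for p
  proof -
    from loc[OF that] obtain U \<phi> V \<psi> W' where c: "(U, \<phi>) \<in> A" "(V, \<psi>) \<in> B"
      and W': "open W'" "p \<in> W'" "W' \<subseteq> U" "F ` W' \<subseteq> V"
      and sm: "smooth_on (\<phi> ` W') (\<lambda>x. \<psi> (F (inv_into U \<phi> x)))" by blast
    have il: "inv_into U \<phi> (\<phi> q) = q" if "q \<in> W'" for q
      using that W'(3) chart_inverse_left[OF A c(1)] by blast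
    have 1: "continuous_on W' \<phi>"
      using chart_continuous[OF A c(1)] W'(3) continuous_on_subset by blast
    have 2: "continuous_on W' (\<lambda>q. \<psi> (F (inv_into U \<phi> (\<phi> q))))"
      by (rule continuous_on_compose2[OF smooth_on_imp_continuous_on[OF sm] 1]) auto
    have "continuous_on W' (\<lambda>q. inv_into V \<psi> (\<psi> (F (inv_into U \<phi> (\<phi> q)))))"
      by (rule continuous_on_compose2[OF chart_inverse_continuous[OF B c(2)] 2])
        (use W' il in auto)
    then have "continuous_on W' F"
      by (rule continuous_on_eq)
        (use W' il chart_inverse_left[OF B c(2)] in auto)
    then show ?thesis using W' continuous_on_eq_continuous_at by blast
  qed
  then have cont: "continuous_on W F" by (simp add: continuous_at_imp_continuous_on)
  moreover have "smooth_on (\<phi>\<^sub>1 ` (U\<^sub>1 \<inter> W \<inter> F -` V\<^sub>1)) (\<psi>\<^sub>1 \<circ> F \<circ> inv_into U\<^sub>1 \<phi>\<^sub>1)"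
    if c1: "(U\<^sub>1, \<phi>\<^sub>1) \<in> A" "(V\<^sub>1, \<psi>\<^sub>1) \<in> B" for U\<^sub>1 \<phi>\<^sub>1 V\<^sub>1 \<psi>\<^sub>1
  proof -
    let ?S = "U\<^sub>1 \<inter> W \<inter> F -` V\<^sub>1"
    have S: "open ?S"
      using open_Int_vimage[OF W cont chart_open[OF B c1(2)]] chart_open[OF A c1(1)]
      by (simp add: open_Int Int_assoc)
    show ?thesis
    proof (rule smooth_on_local)
      show "open (\<phi>\<^sub>1 ` ?S)" by (rule chart_image_open[OF A c1(1) S]) auto
      fix x assume "x \<in> \<phi>\<^sub>1 ` ?S"
      then obtain p where p: "p \<in> ?S" "x = \<phi>\<^sub>1 p" by blast
      then have "p \<in> W" by simp
      from loc[OF this] obtain U \<phi> V \<psi> W' where c: "(U, \<phi>) \<in> A" "(V, \<psi>) \<in> B"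
        and W': "open W'" "p \<in> W'" "W' \<subseteq> U" "F ` W' \<subseteq> V"
        and sm: "smooth_on (\<phi> ` W') (\<lambda>x. \<psi> (F (inv_into U \<phi> x)))" by blast
      define T where "T = W' \<inter> ?S"
      note il = chart_inverse_left[OF A c1(1)] chart_inverse_left[OF A c(1)] chart_inverse_left[OF B c(2)]
      have T: "open T" "p \<in> T" "T \<subseteq> U\<^sub>1" "T \<subseteq> W'" "T \<subseteq> U" "F ` T \<subseteq> V" "F ` T \<subseteq> V\<^sub>1"
        using S W' p by (auto simp: T_def)
      have oT: "open (\<phi>\<^sub>1 ` T)" by (rule chart_image_open[OF A c1(1) T(1,3)])
      have oI: "open (\<phi>\<^sub>1 ` (U\<^sub>1 \<inter> U))"
        by (rule chart_image_open[OF A c1(1)]) (auto intro: chart_open[OF A c1(1)] chart_open[OF A c(1)])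
      have oJ: "open (\<psi> ` (V \<inter> V\<^sub>1))"
        by (rule chart_image_open[OF B c(2)]) (auto intro: chart_open[OF B c(2)] chart_open[OF B c1(2)])
      have oW': "open (\<phi> ` W')" by (rule chart_image_open[OF A c(1) W'(1,3)])
      have "smooth_on (\<phi>\<^sub>1 ` T) (\<lambda>x. \<phi> (inv_into U\<^sub>1 \<phi>\<^sub>1 x))"
        by (rule smooth_on_subset[OF transition_smooth[OF A c1(1) c(1)] oI oT]) (use T in auto)
      then have "smooth_on (\<phi>\<^sub>1 ` T) (\<lambda>x. \<psi> (F (inv_into U \<phi> (\<phi> (inv_into U\<^sub>1 \<phi>\<^sub>1 x)))))"
        by (rule smooth_on_compose[OF _ sm oT oW']) (use il T in force)
      then have "smooth_on (\<phi>\<^sub>1 ` T)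
          (\<lambda>x. \<psi>\<^sub>1 (inv_into V \<psi> (\<psi> (F (inv_into U \<phi> (\<phi> (inv_into U\<^sub>1 \<phi>\<^sub>1 x)))))))"
      proof (rule smooth_on_compose[OF _ transition_smooth[OF B c(2) c1(2)] oT oJ])
        show "(\<lambda>x. \<psi> (F (inv_into U \<phi> (\<phi> (inv_into U\<^sub>1 \<phi>\<^sub>1 x))))) ` \<phi>\<^sub>1 ` T \<subseteq> \<psi> ` (V \<inter> V\<^sub>1)"
        proof clarify
          fix q assume q: "q \<in> T"
          then have "q \<in> U\<^sub>1" "q \<in> U" using T by auto
          then have "\<psi> (F (inv_into U \<phi> (\<phi> (inv_into U\<^sub>1 \<phi>\<^sub>1 (\<phi>\<^sub>1 q))))) = \<psi> (F q)"
            using il by simp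
          then show "\<psi> (F (inv_into U \<phi> (\<phi> (inv_into U\<^sub>1 \<phi>\<^sub>1 (\<phi>\<^sub>1 q))))) \<in> \<psi> ` (V \<inter> V\<^sub>1)"
            using q T(6,7) by (metis IntI image_eqI image_subset_iff)
        qed
      qed
      then have "smooth_on (\<phi>\<^sub>1 ` T) (\<psi>\<^sub>1 \<circ> F \<circ> inv_into U\<^sub>1 \<phi>\<^sub>1)"
      proof (rule smooth_on_cong[OF oT])
        fix x assume "x \<in> \<phi>\<^sub>1 ` T"
        then obtain q where q: "q \<in> T" "x = \<phi>\<^sub>1 q" by blast
        have "q \<in> U\<^sub>1" "q \<in> U" "F q \<in> V" using q T by auto
        then show "\<psi>\<^sub>1 (inv_into V \<psi> (\<psi> (F (inv_into U \<phi> (\<phi> (inv_into U\<^sub>1 \<phi>\<^sub>1 x)))))) =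
            (\<psi>\<^sub>1 \<circ> F \<circ> inv_into U\<^sub>1 \<phi>\<^sub>1) x"
          using il by (simp add: q(2))
      qed
      then show "\<exists>T. open T \<and> x \<in> T \<and> smooth_on T (\<psi>\<^sub>1 \<circ> F \<circ> inv_into U\<^sub>1 \<phi>\<^sub>1)"
        using oT T(2) p(2) by blast
    qed
  qed
  ultimately show ?thesis by (auto simp: smooth_map_on_def)
qed

lemma smooth_map_on_compose:
  assumes A: "smooth_atlas A" and B: "smooth_atlas B" and C: "smooth_atlas C"
    and F: "smooth_map_on A B W F" "open W" and H: "smooth_map_on B C W' H" "open W'"
  shows "smooth_map_on A C (W \<inter> F -` W') (H \<circ> F)"
proof (rule smooth_map_on_localI[OF A C])
  show "open (W \<inter> F -` W')"
    by (rule open_Int_vimage[OF F(2) smooth_map_on_continuous[OF F(1)] H(2)])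
  fix p assume p: "p \<in> W \<inter> F -` W'"
  obtain U \<phi> where U: "(U, \<phi>) \<in> A" "p \<in> U" using chart_exists[OF A] by blast
  obtain V \<psi> where V: "(V, \<psi>) \<in> B" "F p \<in> V" using chart_exists[OF B] by blast
  obtain X \<eta> where X: "(X, \<eta>) \<in> C" "H (F p) \<in> X" using chart_exists[OF C] by blast
  obtain Q where Q: "open Q" "F p \<in> Q" "Q \<subseteq> V" "H ` Q \<subseteq> X"
    "smooth_on (\<psi> ` Q) (\<lambda>x. \<eta> (H (inv_into V \<psi> x)))"
    using smooth_map_on_chart_nbhd[OF H _ B C V X] p by blast
  obtain P where P: "open P" "p \<in> P" "P \<subseteq> U" "P \<subseteq> W" "F ` P \<subseteq> V"
    "smooth_on (\<phi> ` P) (\<lambda>x. \<psi> (F (inv_into U \<phi> x)))"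
    using smooth_map_on_chart_nbhd[OF F _ A B U V] p by blast
  define R where "R = P \<inter> F -` Q"
  have "continuous_on P F"
    using smooth_map_on_continuous[OF F(1)] P(4) continuous_on_subset by blast
  then have R: "open R" "p \<in> R" "R \<subseteq> U" "F ` R \<subseteq> V" "(H \<circ> F) ` R \<subseteq> X" "R \<subseteq> P"
    using open_Int_vimage[OF P(1) _ Q(1)] P Q by (auto simp: R_def)
  have oR: "open (\<phi> ` R)" by (rule chart_image_open[OF A U(1) R(1,3)])
  have oP: "open (\<phi> ` P)" by (rule chart_image_open[OF A U(1) P(1,3)])
  have oQ: "open (\<psi> ` Q)" by (rule chart_image_open[OF B V(1) Q(1,3)])
  have "smooth_on (\<phi> ` R) (\<lambda>x. \<eta> (H (inv_into V \<psi> (\<psi> (F (inv_into U \<phi> x))))))"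
  proof (rule smooth_on_compose[OF smooth_on_subset[OF P(6) oP oR] Q(5) oR oQ])
    show "\<phi> ` R \<subseteq> \<phi> ` P" using R by blast
    show "(\<lambda>x. \<psi> (F (inv_into U \<phi> x))) ` \<phi> ` R \<subseteq> \<psi> ` Q"
    proof clarify
      fix q assume "q \<in> R"
      then have "q \<in> U" "F q \<in> Q" using R by (auto simp: R_def)
      then show "\<psi> (F (inv_into U \<phi> (\<phi> q))) \<in> \<psi> ` Q"
        by (simp add: chart_inverse_left[OF A U(1)])
    qed
  qed
  then have "smooth_on (\<phi> ` R) (\<lambda>x. \<eta> ((H \<circ> F) (inv_into U \<phi> x)))"
  proof (rule smooth_on_cong[OF oR])
    fix x assume "x \<in> \<phi> ` R"
    then obtain q where q: "q \<in> R" "x = \<phi> q" by blast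
    have "q \<in> U" "F q \<in> V" using q R by auto
    then show "\<eta> (H (inv_into V \<psi> (\<psi> (F (inv_into U \<phi> x))))) = \<eta> ((H \<circ> F) (inv_into U \<phi> x))"
      using chart_inverse_left[OF A U(1)] chart_inverse_left[OF B V(1)] by (simp add: q(2))
  qed
  then show "\<exists>U \<phi> V \<psi> W'. (U, \<phi>) \<in> A \<and> (V, \<psi>) \<in> C \<and> open W' \<and> p \<in> W' \<and>
      W' \<subseteq> U \<and> (H \<circ> F) ` W' \<subseteq> V \<and> smooth_on (\<phi> ` W') (\<lambda>x. \<psi> ((H \<circ> F) (inv_into U \<phi> x)))"
    using U(1) X(1) R by blast
qed

text \<open>A single chart around \<open>p\<close> decides, because transition maps are smooth. The
  open set \<open>O'\<close> depends on \<open>f\<close> and is where coordinate computations with a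
  test function take place.\<close>

lemma smooth_at_iff:
  assumes A: "smooth_atlas A" and U: "(U, \<phi>) \<in> A" "p \<in> U"
  shows "smooth_at A p f \<longleftrightarrow>
    (\<exists>O'. open O' \<and> \<phi> p \<in> O' \<and> O' \<subseteq> \<phi> ` U \<and> smooth_on O' (\<lambda>x. f (inv_into U \<phi> x)))"
proof
  assume "smooth_at A p f"
  then obtain W where W: "open W" "p \<in> W" "smooth_map_on A eucl_atlas W f"
    by (auto simp: smooth_at_def)
  obtain P where P: "open P" "p \<in> P" "P \<subseteq> U" "smooth_on (\<phi> ` P) (\<lambda>x. f (inv_into U \<phi> x))"
    using smooth_map_on_chart_nbhd[OF W(3,1,2) A smooth_atlas_eucl U eucl_chart] by blast
  have "open (\<phi> ` P)" by (rule chart_image_open[OF A U(1) P(1,3)])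
  then show "\<exists>O'. open O' \<and> \<phi> p \<in> O' \<and> O' \<subseteq> \<phi> ` U \<and> smooth_on O' (\<lambda>x. f (inv_into U \<phi> x))"
    using P by (intro exI[of _ "\<phi> ` P"]) auto
next
  assume "\<exists>O'. open O' \<and> \<phi> p \<in> O' \<and> O' \<subseteq> \<phi> ` U \<and> smooth_on O' (\<lambda>x. f (inv_into U \<phi> x))"
  then obtain O' where O': "open O'" "\<phi> p \<in> O'" "O' \<subseteq> \<phi> ` U" "smooth_on O' (\<lambda>x. f (inv_into U \<phi> x))"
    by blast
  define W where "W = U \<inter> \<phi> -` O'"
  have W: "open W" "p \<in> W"
    using open_Int_vimage[OF chart_open[OF A U(1)] chart_continuous[OF A U(1)] O'(1)] U O'
    by (auto simp: W_def)
  have img: "\<phi> ` W = O'" using O'(3) by (auto simp: W_def)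
  have "smooth_map_on A eucl_atlas W f"
  proof (rule smooth_map_on_localI[OF A smooth_atlas_eucl W(1)])
    fix q assume "q \<in> W"
    then show "\<exists>U \<phi> V \<psi> W'. (U, \<phi>) \<in> A \<and> (V, \<psi>) \<in> eucl_atlas \<and> open W' \<and> q \<in> W' \<and>
      W' \<subseteq> U \<and> f ` W' \<subseteq> V \<and> smooth_on (\<phi> ` W') (\<lambda>x. \<psi> (f (inv_into U \<phi> x)))"
      using U W O' img eucl_chart
      by (intro exI[of _ U] exI[of _ \<phi>] exI[of _ UNIV] exI[of _ "\<lambda>x. x"] exI[of _ W])
        (auto simp: W_def)
  qed
  then show "smooth_at A p f" using W by (auto simp: smooth_at_def)
qed

lemma smooth_at_compose:
  assumes "smooth_atlas A" "smooth_map_on A A UNIV F" "smooth_at A (F p) f"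
  shows "smooth_at A p (f \<circ> F)"
proof -
  obtain W where W: "open W" "F p \<in> W" "smooth_map_on A eucl_atlas W f"
    using assms(3) by (auto simp: smooth_at_def)
  have "smooth_map_on A eucl_atlas (UNIV \<inter> F -` W) (f \<circ> F)"
    by (rule smooth_map_on_compose[OF assms(1,1) smooth_atlas_eucl assms(2) open_UNIV W(3,1)])
  moreover have "open (UNIV \<inter> F -` W)"
    by (rule open_Int_vimage[OF open_UNIV smooth_map_on_continuous[OF assms(2)] W(1)])
  ultimately show ?thesis
    unfolding smooth_at_def using W(2) by (intro exI[of _ "UNIV \<inter> F -` W"]) auto
qed

text \<open>The tangent vector at \<open>p\<close> with coordinates \<open>w\<close>. The value 0 on
  functions not smooth at \<open>p\<close> matches \<open>velocity\<close>, so that the two agree as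
  operators.\<close>

definition chart_vector ::
  "('m::topological_space, 'e::euclidean_space) atlas \<Rightarrow> 'm set \<Rightarrow> ('m \<Rightarrow> 'e) \<Rightarrow> 'm \<Rightarrow> 'e \<Rightarrow>
   'm tangent_vector" where
  "chart_vector A U \<phi> p w = (\<lambda>f. if smooth_at A p f
     then frechet_derivative (\<lambda>x. f (inv_into U \<phi> x)) (at (\<phi> p)) w else 0)"

lemma smooth_at_has_derivative:
  assumes A: "smooth_atlas A" and U: "(U, \<phi>) \<in> A" "p \<in> U" and f: "smooth_at A p f"
  shows "((\<lambda>x. f (inv_into U \<phi> x)) has_derivative
    (\<lambda>w. chart_vector A U \<phi> p w f)) (at (\<phi> p))"
proof -
  obtain O' where "open O'" "\<phi> p \<in> O'" "smooth_on O' (\<lambda>x. f (inv_into U \<phi> x))"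
    using smooth_at_iff[OF A U] f by blast
  then show ?thesis using smooth_on_imp_has_derivative f by (simp add: chart_vector_def)
qed

lemma chart_vector_eqI:
  assumes A: "smooth_atlas A" and U: "(U, \<phi>) \<in> A" "p \<in> U" and f: "smooth_at A p f"
    and d: "((\<lambda>x. f (inv_into U \<phi> x)) has_derivative D) (at (\<phi> p))"
  shows "chart_vector A U \<phi> p w f = D w"
  using has_derivative_unique[OF smooth_at_has_derivative[OF A U f] d] by (rule fun_cong)

lemma linear_chart_vector:
  assumes A: "smooth_atlas A" and U: "(U, \<phi>) \<in> A" "p \<in> U"
  shows "linear (chart_vector A U \<phi> p)"
proof
  have lin: "linear (\<lambda>w. chart_vector A U \<phi> p w f)" if "smooth_at A p f" for f
    using smooth_at_has_derivative[OF A U that] by (rule has_derivative_linear)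
  have 0: "chart_vector A U \<phi> p w f = 0" if "\<not> smooth_at A p f" for f w
    using that by (simp add: chart_vector_def)
  show "chart_vector A U \<phi> p (v + w) = chart_vector A U \<phi> p v + chart_vector A U \<phi> p w" for v w
  proof
    show "chart_vector A U \<phi> p (v + w) f = (chart_vector A U \<phi> p v + chart_vector A U \<phi> p w) f" for f
      by (cases "smooth_at A p f") (simp_all add: linear_add[OF lin] 0)
  qed
  show "chart_vector A U \<phi> p (r *\<^sub>R w) = r *\<^sub>R chart_vector A U \<phi> p w" for r w
  proof
    show "chart_vector A U \<phi> p (r *\<^sub>R w) f = (r *\<^sub>R chart_vector A U \<phi> p w) f" for f
      by (cases "smooth_at A p f") (simp_all add: linear_scale[OF lin] 0 scaleR_fun_def)
  qed
qed

text \<open>The coordinate functions \<open>\<lambda>q. \<phi> q \<bullet> b\<close> are smooth at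
  \<open>p\<close>, and on them the operator returns the components of its coordinate
  vector.\<close>

lemma inj_chart_vector:
  assumes A: "smooth_atlas A" and U: "(U, \<phi>) \<in> A" "p \<in> U"
  shows "inj (chart_vector A U \<phi> p)"
proof (rule injI, rule euclidean_eqI)
  fix v w b assume eq: "chart_vector A U \<phi> p v = chart_vector A U \<phi> p w"
  have r: "(x \<bullet> b) = \<phi> (inv_into U \<phi> x) \<bullet> b" if "x \<in> \<phi> ` U" for x
    using that by (simp add: f_inv_into_f)
  have "smooth_on (\<phi> ` U) (\<lambda>x. x \<bullet> b)"
    by (rule smooth_on_bounded_linear[OF chart_range_open[OF A U(1)] bounded_linear_inner_left])
  then have "smooth_on (\<phi> ` U) (\<lambda>x. \<phi> (inv_into U \<phi> x) \<bullet> b)"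
    by (rule smooth_on_cong[OF chart_range_open[OF A U(1)]]) (rule r)
  then have sm: "smooth_at A p (\<lambda>q. \<phi> q \<bullet> b)"
    unfolding smooth_at_iff[OF A U] using chart_range_open[OF A U(1)] U(2) by blast
  have "((\<lambda>x. \<phi> (inv_into U \<phi> x) \<bullet> b) has_derivative (\<lambda>h. h \<bullet> b)) (at (\<phi> p))"
    by (rule has_derivative_transform_within_open[OF _ chart_range_open[OF A U(1)] _ r])
      (use U(2) in \<open>auto intro: bounded_linear_imp_has_derivative bounded_linear_inner_left\<close>)
  from chart_vector_eqI[OF A U sm this] eq show "v \<bullet> b = w \<bullet> b" by metis
qed

lemma velocity_chart:
  assumes A: "smooth_atlas A" and U: "(U, \<phi>) \<in> A" "c 0 \<in> U"
    and ev: "\<forall>\<^sub>F t in nhds 0. c t \<in> U"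
    and d: "((\<lambda>t. \<phi> (c t)) has_vector_derivative w) (at 0)"
  shows "velocity A c = chart_vector A U \<phi> (c 0) w"
proof
  fix f
  show "velocity A c f = chart_vector A U \<phi> (c 0) w f"
  proof (cases "smooth_at A (c 0) f")
    case True
    let ?F = "\<lambda>x. f (inv_into U \<phi> x)" and ?D = "\<lambda>w. chart_vector A U \<phi> (c 0) w f"
    have D: "(?F has_derivative ?D) (at (\<phi> (c 0)))" by (rule smooth_at_has_derivative[OF A U True])
    have "((\<lambda>t. ?F (\<phi> (c t))) has_derivative (\<lambda>h. ?D (h *\<^sub>R w))) (at 0)"
      using has_derivative_compose[OF d[unfolded has_vector_derivative_def] D] .
    moreover have "(\<lambda>h. ?D (h *\<^sub>R w)) = (*) (?D w)"
      by (rule ext) (simp add: linear_scale[OF has_derivative_linear[OF D]] mult.commute)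
    ultimately have "((\<lambda>t. ?F (\<phi> (c t))) has_real_derivative ?D w) (at 0)"
      by (simp add: has_field_derivative_def)
    then have "deriv (\<lambda>t. ?F (\<phi> (c t))) 0 = ?D w" by (rule DERIV_imp_deriv)
    \<comment> \<open>The chart is undone only for \<open>t\<close> near 0, which is all that
      \<open>deriv\<close> sees.\<close>
    moreover have "\<forall>\<^sub>F t in nhds 0. ?F (\<phi> (c t)) = (f \<circ> c) t"
      using ev by eventually_elim (simp add: chart_inverse_left[OF A U(1)])
    then have "deriv (\<lambda>t. ?F (\<phi> (c t))) 0 = deriv (f \<circ> c) 0" by (rule deriv_cong_ev) simp
    ultimately show ?thesis using True by (simp add: velocity_def)
  qed (simp add: velocity_def chart_vector_def)
qed

lemma smooth_curve_chart:
  fixes c :: "real \<Rightarrow> 'm::{t2_space,second_countable_topology}"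
  assumes A: "smooth_atlas A" and U: "(U, \<phi>) \<in> A" "c 0 \<in> U"
    and c: "smooth_map_on eucl_atlas A {-\<epsilon><..<\<epsilon>} c" "\<epsilon> > 0"
  shows "\<forall>\<^sub>F t in nhds 0. c t \<in> U"
    and "\<exists>w. ((\<lambda>t. \<phi> (c t)) has_vector_derivative w) (at 0)"
proof -
  obtain W where W: "open W" "0 \<in> W" "c ` W \<subseteq> U" "smooth_on W (\<lambda>t. \<phi> (c t))"
    using smooth_map_on_chart_nbhd[OF c(1) _ _ smooth_atlas_eucl A eucl_chart _ U] c(2)
    by (auto simp: inv_into_UNIV_ident)
  then show "\<forall>\<^sub>F t in nhds 0. c t \<in> U" by (auto simp: eventually_nhds)
  have "(\<lambda>t. \<phi> (c t)) differentiable (at 0)"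
    using smooth_on_imp_has_derivative[OF W(4,1,2)] by (auto simp: differentiable_def)
  then show "\<exists>w. ((\<lambda>t. \<phi> (c t)) has_vector_derivative w) (at 0)"
    using vector_derivative_works by blast
qed

text \<open>By definition velocities form a mere set. Here they become the image of the linear
  injection \<open>chart_vector A U \<phi> p\<close>; each coordinate vector is realized by a
  straight line in the chart.\<close>

lemma tangent_space_chart:
  fixes A :: "('m::{t2_space,second_countable_topology}, 'e::euclidean_space) atlas"
  assumes A: "smooth_atlas A" and U: "(U, \<phi>) \<in> A" "p \<in> U"
  shows "tangent_space A p = range (chart_vector A U \<phi> p)"
proof (intro equalityI subsetI)
  fix X assume "X \<in> tangent_space A p"
  then obtain c \<epsilon> where c: "X = velocity A c" "c 0 = p" "\<epsilon> > 0" "smooth_map_on eucl_atlas A {-\<epsilon><..<\<epsilon>} c"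
    by (auto simp: tangent_space_def)
  then show "X \<in> range (chart_vector A U \<phi> p)"
    using smooth_curve_chart[OF A U(1) _ c(4,3)] velocity_chart[OF A U(1)] U(2) by blast
next
  fix X assume "X \<in> range (chart_vector A U \<phi> p)"
  then obtain w where w: "X = chart_vector A U \<phi> p w" by blast
  let ?l = "\<lambda>t. \<phi> p + t *\<^sub>R w"
  define c where "c t = inv_into U \<phi> (?l t)" for t
  have "continuous_on UNIV ?l" by (intro continuous_intros)
  then have "open (UNIV \<inter> ?l -` (\<phi> ` U))"
    by (rule open_Int_vimage[OF open_UNIV _ chart_range_open[OF A U(1)]])
  moreover have "0 \<in> UNIV \<inter> ?l -` (\<phi> ` U)" using U by simp
  ultimately obtain \<epsilon> where e: "\<epsilon> > 0" "ball 0 \<epsilon> \<subseteq> ?l -` (\<phi> ` U)"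
    by (metis openE Int_UNIV_left)
  have ball: "{-\<epsilon><..<\<epsilon>} = ball 0 \<epsilon>" by (auto simp: dist_real_def)
  have c0: "c 0 = p" using U by (simp add: c_def chart_inverse_left[OF A U(1)])
  have cU: "c t \<in> U" "\<phi> (c t) = ?l t" if "t \<in> ball 0 \<epsilon>" for t
    using e(2) that by (auto simp: c_def inv_into_into f_inv_into_f)
  have "smooth_on (ball 0 \<epsilon>) ?l"
    by (intro smooth_on_add open_ball smooth_on_const smooth_on_bounded_linear
        bounded_linear_scaleR_left)
  then have sm: "smooth_on (ball 0 \<epsilon>) (\<lambda>t. \<phi> (c t))"
    by (rule smooth_on_cong[OF open_ball]) (simp add: cU)
  have "smooth_map_on eucl_atlas A {-\<epsilon><..<\<epsilon>} c"
    unfolding ball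
  proof (rule smooth_map_on_localI[OF smooth_atlas_eucl A open_ball])
    fix t :: real assume "t \<in> ball 0 \<epsilon>"
    then show "\<exists>U \<phi> V \<psi> W'. (U, \<phi>) \<in> eucl_atlas \<and> (V, \<psi>) \<in> A \<and> open W' \<and> t \<in> W' \<and> W' \<subseteq> U \<and>
      c ` W' \<subseteq> V \<and> smooth_on (\<phi> ` W') (\<lambda>x. \<psi> (c (inv_into U \<phi> x)))"
      using U sm cU eucl_chart
      by (intro exI[of _ UNIV] exI[of _ "\<lambda>x. x"] exI[of _ U] exI[of _ \<phi>] exI[of _ "ball 0 \<epsilon>"])
        (auto simp: inv_into_UNIV_ident)
  qed
  then have 1: "velocity A c \<in> tangent_space A p"
    using e(1) c0 by (auto simp: tangent_space_def)
  have ev: "\<forall>\<^sub>F t in nhds 0. t \<in> ball 0 \<epsilon>"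
    using e(1) by (intro eventually_nhds_in_open) auto
  then have evU: "\<forall>\<^sub>F t in nhds 0. c t \<in> U" by eventually_elim (rule cU(1))
  have "(?l has_vector_derivative w) (at 0)"
    by (auto intro!: derivative_eq_intros simp: has_vector_derivative_def)
  then have "((\<lambda>t. \<phi> (c t)) has_vector_derivative w) (at 0)"
    unfolding has_vector_derivative_def
    by (rule has_derivative_transform_within_open[OF _ open_ball[of 0 \<epsilon>]]) (use e(1) cU in auto)
  then have "velocity A c = chart_vector A U \<phi> (c 0) w"
    using U(2) c0 evU by (intro velocity_chart[OF A U(1)]) auto
  then show "X \<in> tangent_space A p" using 1 w c0 by simp
qed

section \<open>Differentials of smooth maps\<close>

lemma tangent_vector_not_smooth: "X \<in> tangent_space A p \<Longrightarrow> \<not> smooth_at A p f \<Longrightarrow> X f = 0"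
  by (auto simp: tangent_space_def velocity_def)

lemma differential_in_tangent_space:
  fixes A :: "('m::{t2_space,second_countable_topology}, 'e::euclidean_space) atlas"
  assumes A: "smooth_atlas A" and F: "smooth_map_on A A UNIV F" and X: "X \<in> tangent_space A p"
  shows "differential A F p X \<in> tangent_space A (F p)"
proof -
  obtain c \<epsilon> where c: "X = velocity A c" "c 0 = p" "\<epsilon> > 0" "smooth_map_on eucl_atlas A {-\<epsilon><..<\<epsilon>} c"
    using X by (auto simp: tangent_space_def)
  have "differential A F p X = velocity A (F \<circ> c)"
    using smooth_at_compose[OF A F] c(2)
    by (auto simp: fun_eq_iff differential_def velocity_def c(1) o_assoc)
  moreover have "smooth_map_on eucl_atlas A ({-\<epsilon><..<\<epsilon>} \<inter> c -` UNIV) (F \<circ> c)"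
    by (rule smooth_map_on_compose[OF smooth_atlas_eucl A A c(4) _ F]) auto
  then have "smooth_map_on eucl_atlas A {-\<epsilon><..<\<epsilon>} (F \<circ> c)" by simp
  ultimately show ?thesis
    using c(2,3) by (auto simp: tangent_space_def)
qed

text \<open>Smoothness of the outer map \<open>F\<close> makes \<open>f \<circ> F\<close> smooth at
  \<open>H p\<close> whenever \<open>f\<close> is smooth at its image, so the default value 0 of the
  inner differential never intervenes.\<close>

lemma differential_compose:
  assumes "smooth_atlas A" "smooth_map_on A A UNIV F"
  shows "differential A (F \<circ> H) p X = differential A F (H p) (differential A H p X)"
  using smooth_at_compose[OF assms] by (auto simp: fun_eq_iff differential_def o_assoc)

text \<open>A tangent vector already vanishes on functions not smooth at \<open>p\<close>, in
  agreement with the default value in \<open>differential\<close>.\<close>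

lemma differential_id: "X \<in> tangent_space A p \<Longrightarrow> differential A (\<lambda>x. x) p X = X"
  using tangent_vector_not_smooth by (fastforce simp: fun_eq_iff differential_def o_def)

text \<open>One chart has to contain both \<open>p\<close> and \<open>F p\<close>. This fits
  conjugations and inversion, which fix the identity.\<close>

lemma differential_chart:
  fixes A :: "('m::{t2_space,second_countable_topology}, 'e::euclidean_space) atlas"
  assumes A: "smooth_atlas A" and F: "smooth_map_on A A UNIV F"
    and U: "(U, \<phi>) \<in> A" "p \<in> U" "F p \<in> U"
    and d: "((\<lambda>x. \<phi> (F (inv_into U \<phi> x))) has_derivative D) (at (\<phi> p))"
  shows "differential A F p (chart_vector A U \<phi> p w) = chart_vector A U \<phi> (F p) (D w)"
proof
  fix f
  show "differential A F p (chart_vector A U \<phi> p w) f = chart_vector A U \<phi> (F p) (D w) f"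
  proof (cases "smooth_at A (F p) f")
    case True
    obtain W where W: "open W" "p \<in> W" "W \<subseteq> U" "F ` W \<subseteq> U"
      using smooth_map_on_chart_nbhd[OF F open_UNIV _ A A U(1,2,1,3)] by blast
    have p: "inv_into U \<phi> (\<phi> p) = p" using U by (simp add: chart_inverse_left[OF A U(1)])
    have "((\<lambda>x. f (inv_into U \<phi> x)) has_derivative (\<lambda>w. chart_vector A U \<phi> (F p) w f))
      (at (\<phi> (F (inv_into U \<phi> (\<phi> p)))))"
      unfolding p by (rule smooth_at_has_derivative[OF A U(1,3) True])
    from has_derivative_compose[OF d this]
    have "((\<lambda>x. (f \<circ> F) (inv_into U \<phi> x)) has_derivative (\<lambda>w. chart_vector A U \<phi> (F p) (D w) f))
      (at (\<phi> p))"
    proof (rule has_derivative_transform_within_open)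
      show "open (\<phi> ` W)" by (rule chart_image_open[OF A U(1) W(1,3)])
      show "f (inv_into U \<phi> (\<phi> (F (inv_into U \<phi> x)))) = (f \<circ> F) (inv_into U \<phi> x)"
        if "x \<in> \<phi> ` W" for x
      proof -
        note that
        then obtain q where q: "q \<in> W" "x = \<phi> q" by blast
        then have "q \<in> U" "F q \<in> U" using W by auto
        then show ?thesis using chart_inverse_left[OF A U(1)] by (simp add: q(2))
      qed
    qed (use W in auto)
    from chart_vector_eqI[OF A U(1,2) smooth_at_compose[OF A F True] this] True
    show ?thesis by (simp add: differential_def o_def)
  qed (simp add: differential_def chart_vector_def)
qed

section \<open>Isometries\<close>

lemma IsoD_smooth: "F \<in> Iso A g \<Longrightarrow> smooth_map_on A A UNIV F"
  by (simp add: Iso_def diffeomorphism_def)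

lemma IsoD_metric:
  "F \<in> Iso A g \<Longrightarrow> X \<in> tangent_space A p \<Longrightarrow> Y \<in> tangent_space A p \<Longrightarrow>
    g (F p) (differential A F p X) (differential A F p Y) = g p X Y"
  by (simp add: Iso_def)

lemma Iso_compose:
  fixes A :: "('m::{t2_space,second_countable_topology}, 'e::euclidean_space) atlas"
  assumes A: "smooth_atlas A" and F: "F \<in> Iso A g" and H: "H \<in> Iso A g"
  shows "F \<circ> H \<in> Iso A g"
proof -
  have b: "bij F" "bij H" and i: "smooth_map_on A A UNIV (inv_into UNIV F)" "smooth_map_on A A UNIV (inv_into UNIV H)"
    using F H by (auto simp: Iso_def diffeomorphism_def)
  have "smooth_map_on A A UNIV (F \<circ> H)"
    using smooth_map_on_compose[OF A A A IsoD_smooth[OF H] open_UNIV IsoD_smooth[OF F] open_UNIV] by simp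
  moreover have "smooth_map_on A A UNIV (inv_into UNIV (F \<circ> H))"
    unfolding o_inv_distrib[OF b]
    using smooth_map_on_compose[OF A A A i(1) open_UNIV i(2) open_UNIV] by simp
  ultimately have "diffeomorphism A (F \<circ> H)"
    using b by (simp add: diffeomorphism_def bij_comp)
  moreover have "g ((F \<circ> H) p) (differential A (F \<circ> H) p X) (differential A (F \<circ> H) p Y) = g p X Y"
    if "X \<in> tangent_space A p" "Y \<in> tangent_space A p" for p X Y
    using IsoD_metric[OF F, of _ "H p"] IsoD_metric[OF H that] that
      differential_in_tangent_space[OF A IsoD_smooth[OF H]]
    by (simp add: differential_compose[OF A IsoD_smooth[OF F]])
  ultimately show ?thesis by (simp add: Iso_def)
qed


section \<open>Lie groups in a chart at the identity\<close>

lemma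
  fixes f :: "'a::euclidean_space \<times> 'b::euclidean_space \<Rightarrow> 'c::euclidean_space"
  assumes "smooth_on S f" "open S" "(u, v) \<in> S"
  shows smooth_on_has_derivative_fst:
      "((\<lambda>u. f (u, v)) has_derivative (\<lambda>w. frechet_derivative f (at (u, v)) (w, 0))) (at u)"
    and smooth_on_has_derivative_snd:
      "((\<lambda>v. f (u, v)) has_derivative (\<lambda>w. frechet_derivative f (at (u, v)) (0, w))) (at v)"
proof -
  note d = smooth_on_imp_has_derivative[OF assms]
  have "((\<lambda>u. (u, v)) has_derivative (\<lambda>w. (w, 0))) (at u)"
    by (auto intro!: derivative_eq_intros)
  from has_derivative_compose[OF this d]
  show "((\<lambda>u. f (u, v)) has_derivative (\<lambda>w. frechet_derivative f (at (u, v)) (w, 0))) (at u)" .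
  have "((\<lambda>v. (u, v)) has_derivative (\<lambda>w. (0, w))) (at v)"
    by (auto intro!: derivative_eq_intros)
  from has_derivative_compose[OF this d]
  show "((\<lambda>v. f (u, v)) has_derivative (\<lambda>w. frechet_derivative f (at (u, v)) (0, w))) (at v)" .
qed

section \<open>Translations and conjugations\<close>

locale lie_group_atlas =
  fixes G :: "'n::{t2_space,second_countable_topology} monoid"
    and A :: "('n, 'e::euclidean_space) atlas"
  assumes lie_group: "lie_group G A"
begin

abbreviation mul :: "'n \<Rightarrow> 'n \<Rightarrow> 'n" (infixl "\<cdot>" 70) where "x \<cdot> y \<equiv> x \<otimes>\<^bsub>G\<^esub> y"
abbreviation e :: "'n" where "e \<equiv> \<one>\<^bsub>G\<^esub>"
abbreviation rec :: "'n \<Rightarrow> 'n" where "rec x \<equiv> m_inv G x"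

lemma atlas: "smooth_atlas A"
  and group: "group G"
  and carrier: "x \<in> carrier G"
  and smooth_mul: "smooth_map_on (prod_atlas A A) A UNIV (\<lambda>(x, y). x \<cdot> y)"
  and smooth_rec: "smooth_map_on A A UNIV rec"
  using lie_group by (auto simp: lie_group_def)

lemma mul_assoc: "x \<cdot> y \<cdot> z = x \<cdot> (y \<cdot> z)"
  and e_mul [simp]: "e \<cdot> x = x"
  and mul_e [simp]: "x \<cdot> e = x"
  and rec_mul [simp]: "rec x \<cdot> x = e"
  and mul_rec [simp]: "x \<cdot> rec x = e"
  and rec_rec [simp]: "rec (rec x) = x"
  and rec_e [simp]: "rec e = e"
  and rec_distrib: "rec (x \<cdot> y) = rec y \<cdot> rec x"
proof -
  interpret group G by (rule group)
  show "x \<cdot> y \<cdot> z = x \<cdot> (y \<cdot> z)" "e \<cdot> x = x" "x \<cdot> e = x" "rec x \<cdot> x = e" "x \<cdot> rec x = e"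
    "rec (rec x) = x" "rec e = e" "rec (x \<cdot> y) = rec y \<cdot> rec x"
    by (simp_all add: carrier m_assoc inv_mult_group)
qed

lemma rec_mul_cancel [simp]: "rec x \<cdot> (x \<cdot> y) = y"
  and mul_rec_cancel [simp]: "x \<cdot> (rec x \<cdot> y) = y"
  by (simp_all add: mul_assoc[symmetric])

lemma continuous_mul: "continuous_on S f \<Longrightarrow> continuous_on S h \<Longrightarrow> continuous_on S (\<lambda>z. f z \<cdot> h z)"
  using continuous_on_compose2[OF smooth_map_on_continuous[OF smooth_mul], of S "\<lambda>z. (f z, h z)"]
  by (simp add: continuous_on_Pair)

text \<open>Three charts are allowed because a left translation joins arbitrary points; in the chart
  at the identity all three coincide.\<close>

lemma
  fixes U\<^sub>1 \<phi>\<^sub>1 U\<^sub>2 \<phi>\<^sub>2 V \<psi>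
  assumes U: "(U\<^sub>1, \<phi>\<^sub>1) \<in> A" "(U\<^sub>2, \<phi>\<^sub>2) \<in> A" and V: "(V, \<psi>) \<in> A"
  defines "S \<equiv> {(u, v). u \<in> \<phi>\<^sub>1 ` U\<^sub>1 \<and> v \<in> \<phi>\<^sub>2 ` U\<^sub>2 \<and> inv_into U\<^sub>1 \<phi>\<^sub>1 u \<cdot> inv_into U\<^sub>2 \<phi>\<^sub>2 v \<in> V}"
  shows open_mul_charts: "open S"
    and smooth_mul_charts: "smooth_on S (\<lambda>(u, v). \<psi> (inv_into U\<^sub>1 \<phi>\<^sub>1 u \<cdot> inv_into U\<^sub>2 \<phi>\<^sub>2 v))"
proof -
  let ?P = "\<phi>\<^sub>1 ` U\<^sub>1 \<times> \<phi>\<^sub>2 ` U\<^sub>2"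
  let ?m = "\<lambda>z. inv_into U\<^sub>1 \<phi>\<^sub>1 (fst z) \<cdot> inv_into U\<^sub>2 \<phi>\<^sub>2 (snd z)"
  have "continuous_on ?P ?m"
    by (intro continuous_mul continuous_on_compose2[OF chart_inverse_continuous[OF atlas U(1)]]
        continuous_on_compose2[OF chart_inverse_continuous[OF atlas U(2)]] continuous_intros) auto
  then have "open (?P \<inter> ?m -` V)"
    by (intro open_Int_vimage open_Times chart_range_open[OF atlas] chart_open[OF atlas V] U)
  moreover have S: "S = ?P \<inter> ?m -` V" by (auto simp: S_def)
  ultimately show oS: "open S" by simp
  let ?\<Phi> = "map_prod \<phi>\<^sub>1 \<phi>\<^sub>2"
  have inj: "inj_on ?\<Phi> (U\<^sub>1 \<times> U\<^sub>2)"
    by (intro map_prod_inj_on chart_inj[OF atlas] U)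
  have inv: "inv_into (U\<^sub>1 \<times> U\<^sub>2) ?\<Phi> z = (inv_into U\<^sub>1 \<phi>\<^sub>1 (fst z), inv_into U\<^sub>2 \<phi>\<^sub>2 (snd z))"
    if "z \<in> ?P" for z
    by (rule inv_into_f_eq[OF inj]) (use that in \<open>auto simp: inv_into_into f_inv_into_f\<close>)
  have chart: "(U\<^sub>1 \<times> U\<^sub>2, ?\<Phi>) \<in> prod_atlas A A"
    using U by (auto simp: prod_atlas_def)
  have SI: "S = ?\<Phi> ` (U\<^sub>1 \<times> U\<^sub>2 \<inter> UNIV \<inter> (\<lambda>(x, y). x \<cdot> y) -` V)"
  proof (intro equalityI subsetI)
    fix z assume z: "z \<in> S"
    then have "z \<in> ?P" by (auto simp: S)
    then have "?\<Phi> (inv_into U\<^sub>1 \<phi>\<^sub>1 (fst z), inv_into U\<^sub>2 \<phi>\<^sub>2 (snd z)) = z"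
      "inv_into U\<^sub>1 \<phi>\<^sub>1 (fst z) \<in> U\<^sub>1" "inv_into U\<^sub>2 \<phi>\<^sub>2 (snd z) \<in> U\<^sub>2"
      by (auto simp: inv_into_into f_inv_into_f)
    then show "z \<in> ?\<Phi> ` (U\<^sub>1 \<times> U\<^sub>2 \<inter> UNIV \<inter> (\<lambda>(x, y). x \<cdot> y) -` V)"
      using z by (intro image_eqI[of _ _ "(inv_into U\<^sub>1 \<phi>\<^sub>1 (fst z), inv_into U\<^sub>2 \<phi>\<^sub>2 (snd z))"])
        (auto simp: S)
  next
    fix z assume "z \<in> ?\<Phi> ` (U\<^sub>1 \<times> U\<^sub>2 \<inter> UNIV \<inter> (\<lambda>(x, y). x \<cdot> y) -` V)"
    then show "z \<in> S"
      using chart_inverse_left[OF atlas U(1)] chart_inverse_left[OF atlas U(2)] by (auto simp: S)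
  qed
  have "smooth_on S (\<lambda>z. \<psi> ((\<lambda>(x, y). x \<cdot> y) (inv_into (U\<^sub>1 \<times> U\<^sub>2) ?\<Phi> z)))"
    using smooth_map_onD[OF smooth_mul chart V] unfolding SI .
  then show "smooth_on S (\<lambda>(u, v). \<psi> (inv_into U\<^sub>1 \<phi>\<^sub>1 u \<cdot> inv_into U\<^sub>2 \<phi>\<^sub>2 v))"
    by (rule smooth_on_cong[OF oS]) (use inv in \<open>auto simp: S\<close>)
qed

lemma smooth_map_left_translation: "smooth_map_on A A UNIV (left_translation G a)"
proof (rule smooth_map_on_localI[OF atlas atlas open_UNIV])
  fix p
  obtain U\<^sub>1 \<phi>\<^sub>1 where U1: "(U\<^sub>1, \<phi>\<^sub>1) \<in> A" "a \<in> U\<^sub>1" using chart_exists[OF atlas] by blast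
  obtain U\<^sub>2 \<phi>\<^sub>2 where U2: "(U\<^sub>2, \<phi>\<^sub>2) \<in> A" "p \<in> U\<^sub>2" using chart_exists[OF atlas] by blast
  obtain V \<psi> where V: "(V, \<psi>) \<in> A" "a \<cdot> p \<in> V" using chart_exists[OF atlas] by blast
  note il = chart_inverse_left[OF atlas U1(1)] chart_inverse_left[OF atlas U2(1)]
  define W where "W = U\<^sub>2 \<inter> left_translation G a -` V"
  have W: "open W" unfolding W_def left_translation_def
    by (intro open_Int_vimage continuous_mul chart_open[OF atlas U2(1)] chart_open[OF atlas V(1)]
        continuous_intros)
  have oW: "open (\<phi>\<^sub>2 ` W)" by (rule chart_image_open[OF atlas U2(1) W]) (simp add: W_def)
  \<comment> \<open>The first factor is frozen at the coordinate of \<open>a\<close>, so smoothness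
    is inherited from the multiplication in two variables.\<close>
  have "smooth_on (\<phi>\<^sub>2 ` W) (\<lambda>v. (\<lambda>(u, v). \<psi> (inv_into U\<^sub>1 \<phi>\<^sub>1 u \<cdot> inv_into U\<^sub>2 \<phi>\<^sub>2 v)) (\<phi>\<^sub>1 a, v))"
    by (rule smooth_on_compose[OF _ smooth_mul_charts[OF U1(1) U2(1) V(1)] oW
          open_mul_charts[OF U1(1) U2(1) V(1)]])
      (use U1 il in \<open>auto simp: W_def left_translation_def
        intro!: smooth_on_Pair smooth_on_const smooth_on_ident oW[unfolded W_def left_translation_def]\<close>)
  then have "smooth_on (\<phi>\<^sub>2 ` W) (\<lambda>v. \<psi> (left_translation G a (inv_into U\<^sub>2 \<phi>\<^sub>2 v)))"
    using U1 il by (simp add: left_translation_def)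
  then show "\<exists>U \<phi> V \<psi> W'. (U, \<phi>) \<in> A \<and> (V, \<psi>) \<in> A \<and> open W' \<and> p \<in> W' \<and> W' \<subseteq> U \<and>
      left_translation G a ` W' \<subseteq> V \<and>
      smooth_on (\<phi> ` W') (\<lambda>x. \<psi> (left_translation G a (inv_into U \<phi> x)))"
    using U2 V W
    by (intro exI[of _ U\<^sub>2] exI[of _ \<phi>\<^sub>2] exI[of _ V] exI[of _ \<psi>] exI[of _ W])
      (auto simp: W_def left_translation_def)
qed

text \<open>From \<open>(a^-1 x^-1)^-1 = x a\<close>. Smoothness of right translations is thus
  inherited from left translations and inversion.\<close>

lemma right_translation_eq: "right_translation G a = rec \<circ> left_translation G (rec a) \<circ> rec"
  by (simp add: fun_eq_iff left_translation_def right_translation_def rec_distrib)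

lemma smooth_map_right_translation: "smooth_map_on A A UNIV (right_translation G a)"
  unfolding right_translation_eq
  using smooth_map_on_compose[OF atlas atlas atlas smooth_rec open_UNIV
      smooth_map_on_compose[OF atlas atlas atlas smooth_map_left_translation open_UNIV smooth_rec open_UNIV]]
  by (simp add: o_assoc)

definition conjugation :: "'n \<Rightarrow> 'n \<Rightarrow> 'n" where
  "conjugation a x = a \<cdot> x \<cdot> rec a"

lemma conjugation_eq: "conjugation a = left_translation G a \<circ> right_translation G (rec a)"
  by (simp add: fun_eq_iff conjugation_def left_translation_def right_translation_def mul_assoc)

lemma smooth_map_conjugation: "smooth_map_on A A UNIV (conjugation a)"
  unfolding conjugation_eq
  using smooth_map_on_compose[OF atlas atlas atlas smooth_map_right_translation open_UNIV
      smooth_map_left_translation open_UNIV]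
  by simp

lemma conjugation_e [simp]: "conjugation a e = e"
  by (simp add: conjugation_def)

lemma left_invariant_field_e:
  "X \<in> lie_algebra G A \<Longrightarrow> left_invariant_field G A X e = X"
  unfolding left_invariant_field_def lie_algebra_def
  using differential_id by (simp add: left_translation_def)

end

section \<open>A chart at the identity\<close>

locale lie_group_chart = lie_group_atlas G A
  for G :: "'n::{t2_space,second_countable_topology} monoid"
    and A :: "('n, 'e::euclidean_space) atlas" +
  fixes U :: "'n set" and \<phi> :: "'n \<Rightarrow> 'e"
  assumes chart: "(U, \<phi>) \<in> A" and e_in_chart: "e \<in> U"
begin

abbreviation \<xi> :: "'e \<Rightarrow> 'n" where "\<xi> \<equiv> inv_into U \<phi>"
abbreviation \<theta> :: "'e" where "\<theta> \<equiv> \<phi> e"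
abbreviation tv :: "'e \<Rightarrow> 'n tangent_vector" where "tv \<equiv> chart_vector A U \<phi> e"

definition M :: "('e \<times> 'e) set" where
  "M = {(u, v). u \<in> \<phi> ` U \<and> v \<in> \<phi> ` U \<and> \<xi> u \<cdot> \<xi> v \<in> U}"

definition \<mu> :: "'e \<times> 'e \<Rightarrow> 'e" where "\<mu> = (\<lambda>(u, v). \<phi> (\<xi> u \<cdot> \<xi> v))"

definition I :: "'e set" where "I = {u \<in> \<phi> ` U. rec (\<xi> u) \<in> U}"

text \<open>The condition \<open>(u, v) \<in> M\<close> keeps the intermediate product
  \<open>\<xi> u \<cdot> \<xi> v\<close> in the chart, so that conjugation can be written as two
  applications of \<open>\<mu>\<close>.\<close>

definition N :: "('e \<times> 'e) set" where
  "N = {(u, v). u \<in> I \<and> (u, v) \<in> M \<and> conjugation (\<xi> u) (\<xi> v) \<in> U}"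

definition K :: "'e \<times> 'e \<Rightarrow> 'e" where "K = (\<lambda>(u, v). \<phi> (conjugation (\<xi> u) (\<xi> v)))"

lemma \<xi>_\<phi> [simp]: "x \<in> U \<Longrightarrow> \<xi> (\<phi> x) = x"
  by (rule chart_inverse_left[OF atlas chart])

lemma \<phi>_\<xi> [simp]: "u \<in> \<phi> ` U \<Longrightarrow> \<phi> (\<xi> u) = u"
  by (rule f_inv_into_f)

lemma \<xi>_in [simp]: "u \<in> \<phi> ` U \<Longrightarrow> \<xi> u \<in> U"
  by (rule inv_into_into)

lemma o_in [simp]: "\<theta> \<in> \<phi> ` U"
  using e_in_chart by simp

lemma \<xi>_o [simp]: "\<xi> \<theta> = e"
  using e_in_chart by simp

lemma open_range: "open (\<phi> ` U)"
  by (rule chart_range_open[OF atlas chart])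

lemma open_M: "open M" and smooth_\<mu>: "smooth_on M \<mu>"
  unfolding M_def \<mu>_def using open_mul_charts[OF chart chart chart] smooth_mul_charts[OF chart chart chart]
  by auto

lemma I_eq: "I = \<phi> ` (U \<inter> UNIV \<inter> rec -` U)"
proof (intro equalityI subsetI)
  fix u assume "u \<in> I"
  then show "u \<in> \<phi> ` (U \<inter> UNIV \<inter> rec -` U)"
    by (intro image_eqI[of _ _ "\<xi> u"]) (auto simp: I_def)
qed (auto simp: I_def)

lemma open_I: "open I"
proof -
  have "open (U \<inter> UNIV \<inter> rec -` U)"
    using open_Int_vimage[OF chart_open[OF atlas chart] _ chart_open[OF atlas chart], of rec]
      smooth_map_on_continuous[OF smooth_rec] continuous_on_subset by fastforce
  then show ?thesis unfolding I_eq by (rule chart_image_open[OF atlas chart]) auto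
qed

lemma smooth_\<iota>: "smooth_on I (\<lambda>u. \<phi> (rec (\<xi> u)))"
  using smooth_map_onD[OF smooth_rec chart chart] by (simp add: I_eq)

lemma I_subset: "I \<subseteq> \<phi> ` U"
  by (auto simp: I_def)

lemma o_in_I [simp]: "\<theta> \<in> I"
  using e_in_chart by (simp add: I_def)

text \<open>On \<open>N\<close>, \<open>K (u, v)\<close> equals
  \<open>\<mu> (\<mu> (u, v), \<phi> (rec (\<xi> u)))\<close>, a composition of smooth maps; the
  same formula exhibits \<open>N\<close> as a preimage of \<open>M\<close>.\<close>

lemma open_N: "open N" and smooth_K: "smooth_on N K"
proof -
  let ?T = "M \<inter> I \<times> UNIV"
  let ?h = "\<lambda>z. (\<mu> z, \<phi> (rec (\<xi> (fst z))))"
  have oT: "open ?T" by (intro open_Int open_M open_Times open_I open_UNIV)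
  have "smooth_on ?T fst"
    by (rule smooth_on_bounded_linear[OF oT bounded_linear_fst])
  then have "smooth_on ?T (\<lambda>z. \<phi> (rec (\<xi> (fst z))))"
    by (rule smooth_on_compose[OF _ smooth_\<iota> oT open_I]) auto
  then have h: "smooth_on ?T ?h"
    by (intro smooth_on_Pair oT smooth_on_subset[OF smooth_\<mu> open_M oT]) auto
  have "?h (u, v) \<in> M \<longleftrightarrow> conjugation (\<xi> u) (\<xi> v) \<in> U" if "u \<in> I" "(u, v) \<in> M" for u v
    using that by (simp add: M_def \<mu>_def I_def conjugation_def imageI)
  then have N: "N = ?T \<inter> ?h -` M" by (auto simp: N_def)
  moreover have oN: "open (?T \<inter> ?h -` M)"
    by (rule open_Int_vimage[OF oT smooth_on_imp_continuous_on[OF h] open_M])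
  ultimately show oN: "open N" by simp
  have "smooth_on N (\<lambda>z. \<mu> (?h z))"
    by (rule smooth_on_compose[OF smooth_on_subset[OF h oT oN] smooth_\<mu> oN open_M])
      (auto simp: N)
  then show "smooth_on N K"
    by (rule smooth_on_cong[OF oN]) (auto simp: N_def M_def \<mu>_def K_def conjugation_def I_def)
qed

lemma in_M_left: "u \<in> \<phi> ` U \<Longrightarrow> (u, \<theta>) \<in> M"
  and in_M_right: "u \<in> \<phi> ` U \<Longrightarrow> (\<theta>, u) \<in> M"
  and \<mu>_o_right [simp]: "u \<in> \<phi> ` U \<Longrightarrow> \<mu> (u, \<theta>) = u"
  and \<mu>_o_left [simp]: "u \<in> \<phi> ` U \<Longrightarrow> \<mu> (\<theta>, u) = u"
  by (simp_all add: M_def \<mu>_def)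

lemma in_N: "u \<in> I \<Longrightarrow> (u, \<theta>) \<in> N"
  and K_o [simp]: "K (u, \<theta>) = \<theta>"
  using I_subset e_in_chart by (auto simp: N_def in_M_left K_def)

text \<open>In coordinates, \<open>Q u\<close> and \<open>P u\<close> are the differentials at the identity of the left and right
  translation by \<open>\<xi> u\<close>, and \<open>C u\<close> is \<open>Ad (\<xi> u)\<close>.\<close>

definition P :: "'e \<Rightarrow> 'e \<Rightarrow> 'e" where "P u w = frechet_derivative \<mu> (at (\<theta>, u)) (w, 0)"
definition Q :: "'e \<Rightarrow> 'e \<Rightarrow> 'e" where "Q u w = frechet_derivative \<mu> (at (u, \<theta>)) (0, w)"
definition C :: "'e \<Rightarrow> 'e \<Rightarrow> 'e" where "C u w = frechet_derivative K (at (u, \<theta>)) (0, w)"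
definition dP :: "'e \<Rightarrow> 'e \<Rightarrow> 'e" where "dP h w = frechet_derivative (\<lambda>u. P u w) (at \<theta>) h"
definition dQ :: "'e \<Rightarrow> 'e \<Rightarrow> 'e" where "dQ h w = frechet_derivative (\<lambda>u. Q u w) (at \<theta>) h"
text \<open>The derivative of \<open>Ad\<close> at the identity: \<open>h\<close> is the direction
  in which the group element moves and \<open>w\<close> the vector acted on, so this is
  \<open>ad h w\<close> in coordinates.\<close>

definition dC :: "'e \<Rightarrow> 'e \<Rightarrow> 'e" where "dC h w = frechet_derivative (\<lambda>u. C u w) (at \<theta>) h"

section \<open>The adjoint representation and its derivative in coordinates\<close>

lemma P_has_derivative: "u \<in> \<phi> ` U \<Longrightarrow> ((\<lambda>v. \<mu> (v, u)) has_derivative P u) (at \<theta>)"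
  using smooth_on_has_derivative_fst[OF smooth_\<mu> open_M in_M_right] by (simp add: P_def[abs_def])

lemma Q_has_derivative: "u \<in> \<phi> ` U \<Longrightarrow> ((\<lambda>v. \<mu> (u, v)) has_derivative Q u) (at \<theta>)"
  using smooth_on_has_derivative_snd[OF smooth_\<mu> open_M in_M_left] by (simp add: Q_def[abs_def])

lemma C_has_derivative: "u \<in> I \<Longrightarrow> ((\<lambda>v. K (u, v)) has_derivative C u) (at \<theta>)"
  using smooth_on_has_derivative_snd[OF smooth_K open_N in_N] by (simp add: C_def[abs_def])

lemma smooth_P: "smooth_on (\<phi> ` U) (\<lambda>u. P u w)"
  unfolding P_def
  by (rule smooth_on_compose[OF smooth_on_Pair[OF open_range smooth_on_const[OF open_range]
          smooth_on_ident[OF open_range]]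
          smooth_on_frechet_derivative[OF smooth_\<mu>] open_range open_M])
    (auto intro: in_M_right)

lemma smooth_Q: "smooth_on (\<phi> ` U) (\<lambda>u. Q u w)"
  unfolding Q_def
  by (rule smooth_on_compose[OF smooth_on_Pair[OF open_range smooth_on_ident[OF open_range]
          smooth_on_const[OF open_range]]
          smooth_on_frechet_derivative[OF smooth_\<mu>] open_range open_M])
    (auto intro: in_M_left)

lemma smooth_C: "smooth_on I (\<lambda>u. C u w)"
  unfolding C_def
  by (rule smooth_on_compose[OF smooth_on_Pair[OF open_I smooth_on_ident[OF open_I]
          smooth_on_const[OF open_I]]
          smooth_on_frechet_derivative[OF smooth_K] open_I open_N])
    (auto intro: in_N)

lemma dP_has_derivative: "((\<lambda>u. P u w) has_derivative (\<lambda>h. dP h w)) (at \<theta>)"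
  using smooth_on_imp_has_derivative[OF smooth_P open_range o_in] by (simp add: dP_def)

lemma dQ_has_derivative: "((\<lambda>u. Q u w) has_derivative (\<lambda>h. dQ h w)) (at \<theta>)"
  using smooth_on_imp_has_derivative[OF smooth_Q open_range o_in] by (simp add: dQ_def)

lemma dC_has_derivative: "((\<lambda>u. C u w) has_derivative (\<lambda>h. dC h w)) (at \<theta>)"
  using smooth_on_imp_has_derivative[OF smooth_C open_I o_in_I] by (simp add: dC_def)

lemma P_o [simp]: "P \<theta> w = w" and Q_o [simp]: "Q \<theta> w = w"
proof -
  have "((\<lambda>u. u) has_derivative P \<theta>) (at \<theta>)" "((\<lambda>u. u) has_derivative Q \<theta>) (at \<theta>)"
    by (rule has_derivative_transform_within_open[OF P_has_derivative open_range], simp_all)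
      (rule has_derivative_transform_within_open[OF Q_has_derivative open_range], simp_all)
  from has_derivative_unique[OF this(1) has_derivative_ident]
    has_derivative_unique[OF this(2) has_derivative_ident]
  show "P \<theta> w = w" "Q \<theta> w = w" by (simp_all add: fun_eq_iff)
qed

lemma C_o [simp]: "C \<theta> w = w"
proof -
  have "((\<lambda>u. u) has_derivative C \<theta>) (at \<theta>)"
    by (rule has_derivative_transform_within_open[OF C_has_derivative open_range])
      (simp_all add: K_def conjugation_def)
  from has_derivative_unique[OF this has_derivative_ident] show ?thesis by (simp add: fun_eq_iff)
qed

text \<open>Differentiate \<open>(a x a^-1) a = a x\<close> in \<open>x\<close> at the identity,
  with \<open>a = \<xi> u\<close>.\<close>

lemma P_C: "u \<in> I \<Longrightarrow> P u (C u w) = Q u w"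
proof -
  assume u: "u \<in> I"
  then have uU: "u \<in> \<phi> ` U" using I_subset by blast
  have "((\<lambda>k. \<mu> (k, u)) has_derivative P u) (at (K (u, \<theta>)))"
    using P_has_derivative[OF uU] by simp
  from has_derivative_compose[OF C_has_derivative[OF u] this]
  have "((\<lambda>v. \<mu> (u, v)) has_derivative (\<lambda>w. P u (C u w))) (at \<theta>)"
  proof (rule has_derivative_transform_within_open)
    show "open (UNIV \<inter> (\<lambda>v. (u, v)) -` N)"
      by (intro open_Int_vimage open_N open_UNIV continuous_intros)
    show "\<mu> (K (u, v), u) = \<mu> (u, v)" if "v \<in> UNIV \<inter> (\<lambda>v. (u, v)) -` N" for v
      using that by (auto simp: N_def M_def \<mu>_def K_def conjugation_def mul_assoc)
  qed (simp add: in_N u)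
  from has_derivative_unique[OF this Q_has_derivative[OF uU]] show ?thesis by (simp add: fun_eq_iff)
qed

text \<open>At \<open>\<theta>\<close> both \<open>P\<close> and \<open>C\<close> are the identity,
  so the product rule applied to \<open>P_C\<close> reads
  \<open>dC h w + dP h w = dQ h w\<close>.\<close>

lemma dC_eq: "dC h w = dQ h w - dP h w"
proof -
  have "((\<lambda>u. P u (C u w)) has_derivative (\<lambda>h. P \<theta> (dC h w) + dP h (C \<theta> w))) (at \<theta>)"
    using I_subset has_derivative_linear[OF P_has_derivative]
    by (intro has_derivative_linear_family[OF open_I o_in_I] dP_has_derivative dC_has_derivative) auto
  then have "((\<lambda>u. Q u w) has_derivative (\<lambda>h. P \<theta> (dC h w) + dP h (C \<theta> w))) (at \<theta>)"
    by (rule has_derivative_transform_within_open[OF _ open_I o_in_I]) (rule P_C)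
  from has_derivative_unique[OF this dQ_has_derivative] show ?thesis by (simp add: fun_eq_iff algebra_simps)
qed

text \<open>Both sides are mixed second derivatives of \<open>\<mu>\<close> at
  \<open>(\<theta>, \<theta>)\<close> in the directions \<open>(w, 0)\<close> and
  \<open>(0, h)\<close>, taken in opposite orders.\<close>

lemma dP_swap: "dP h w = dQ w h"
proof -
  have oo: "(\<theta>, \<theta>) \<in> M" by (simp add: in_M_left)
  have "dP h w = frechet_derivative (\<lambda>y. frechet_derivative \<mu> (at y) (w, 0)) (at (\<theta>, \<theta>)) (0, h)"
    using has_derivative_unique[OF dP_has_derivative
        smooth_on_has_derivative_snd[OF smooth_on_frechet_derivative[OF smooth_\<mu>] open_M oo, of "(w, 0)",
          folded P_def]]
    by (simp add: fun_eq_iff)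
  also have "\<dots> = frechet_derivative (\<lambda>y. frechet_derivative \<mu> (at y) (0, h)) (at (\<theta>, \<theta>)) (w, 0)"
    by (rule second_derivative_symmetric[OF open_M oo smooth_\<mu>])
  also have "\<dots> = dQ w h"
    using has_derivative_unique[OF dQ_has_derivative
        smooth_on_has_derivative_fst[OF smooth_on_frechet_derivative[OF smooth_\<mu>] open_M oo, of "(0, h)",
          folded Q_def]]
    by (simp add: fun_eq_iff)
  finally show ?thesis .
qed

lemma dC_antisym: "dC h w = - dC w h"
  by (simp add: dC_eq dP_swap)

section \<open>The Lie bracket in coordinates\<close>

lemma lie_algebra_eq: "lie_algebra G A = range tv"
  unfolding lie_algebra_def by (rule tangent_space_chart[OF atlas chart e_in_chart])

lemma linear_tv: "linear tv"
  by (rule linear_chart_vector[OF atlas chart e_in_chart])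

lemma inj_tv: "inj tv"
  by (rule inj_chart_vector[OF atlas chart e_in_chart])

text \<open>Left translation by \<open>\<xi> u\<close> is \<open>\<mu> (u, _)\<close> in
  coordinates, so the chain rule brings in \<open>Q u\<close>. Evaluation on a test function at a
  variable \<open>u\<close> prepares for the second differentiation in the bracket.\<close>

lemma left_invariant_field_chart:
  assumes "open S" "S \<subseteq> \<phi> ` U" "smooth_on S (\<lambda>x. f (\<xi> x))" "u \<in> S"
  shows "left_invariant_field G A (tv y) (\<xi> u) f = frechet_derivative (\<lambda>x. f (\<xi> x)) (at u) (Q u y)"
proof -
  have u: "u \<in> \<phi> ` U" using assms by blast
  have sm: "smooth_at A (\<xi> u) f"
    unfolding smooth_at_iff[OF atlas chart \<xi>_in[OF u]] using assms u by auto
  have Le: "left_translation G (\<xi> u) e = \<xi> u" by (simp add: left_translation_def)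
  then have sm': "smooth_at A e (f \<circ> left_translation G (\<xi> u))"
    using smooth_at_compose[OF atlas smooth_map_left_translation] sm by simp
  have "((\<lambda>x. f (\<xi> x)) has_derivative frechet_derivative (\<lambda>x. f (\<xi> x)) (at u)) (at (\<mu> (u, \<theta>)))"
    using smooth_on_imp_has_derivative[OF assms(3,1,4)] u by simp
  from has_derivative_compose[OF Q_has_derivative[OF u] this]
  have "((\<lambda>v. (f \<circ> left_translation G (\<xi> u)) (\<xi> v)) has_derivative
      (\<lambda>w. frechet_derivative (\<lambda>x. f (\<xi> x)) (at u) (Q u w))) (at \<theta>)"
  proof (rule has_derivative_transform_within_open)
    show "open (UNIV \<inter> (\<lambda>v. (u, v)) -` M)"
      by (intro open_Int_vimage open_M open_UNIV continuous_intros)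
    show "f (\<xi> (\<mu> (u, v))) = (f \<circ> left_translation G (\<xi> u)) (\<xi> v)"
      if "v \<in> UNIV \<inter> (\<lambda>v. (u, v)) -` M" for v
      using that by (simp add: M_def \<mu>_def left_translation_def)
  qed (simp add: in_M_left u)
  from chart_vector_eqI[OF atlas chart e_in_chart sm' this]
  show ?thesis by (simp add: left_invariant_field_def differential_def Le sm o_def)
qed

text \<open>The product rule for \<open>Df(u) (Q u y)\<close> at \<open>\<theta>\<close>: varying
  the field gives the first-order term, varying \<open>Df\<close> the second-order term. The latter
  is symmetric in \<open>x\<close> and \<open>y\<close> and cancels in the bracket.\<close>

lemma left_invariant_field_derivative:
  assumes f: "smooth_at A e f"
  shows "tv x (\<lambda>q. left_invariant_field G A (tv y) q f) =
    tv (dQ x y) f +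
    frechet_derivative (\<lambda>u. frechet_derivative (\<lambda>x. f (\<xi> x)) (at u) y) (at \<theta>) x"
proof -
  let ?F = "\<lambda>x. f (\<xi> x)"
  let ?B = "\<lambda>u. frechet_derivative ?F (at u)"
  obtain S where S: "open S" "\<theta> \<in> S" "S \<subseteq> \<phi> ` U" "smooth_on S ?F"
    using f smooth_at_iff[OF atlas chart e_in_chart] by blast
  let ?h = "\<lambda>q. left_invariant_field G A (tv y) q f"
  have eq: "?B u (Q u y) = ?h (\<xi> u)" if "u \<in> S" for u
    using left_invariant_field_chart[OF S(1,3,4) that] by simp
  note lin = smooth_on_imp_linear[OF S(4,1)]
  have "smooth_on S (\<lambda>u. ?B u (Q u y))"
    by (rule smooth_on_linear_family[where B = ?B, OF S(1) lin smooth_on_frechet_derivative[OF S(4)]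
          smooth_on_subset[OF smooth_Q open_range S(1,3)]])
  then have "smooth_on S (\<lambda>u. ?h (\<xi> u))"
    by (rule smooth_on_cong[OF S(1)]) (rule eq)
  \<comment> \<open>Tangent vectors take the default value 0 on functions not smooth at the
    identity, so this must precede the evaluation of \<open>tv x\<close> on
    \<open>?h\<close>.\<close>
  then have sm: "smooth_at A e ?h"
    unfolding smooth_at_iff[OF atlas chart e_in_chart] using S by blast
  have "((\<lambda>u. ?B u (Q u y)) has_derivative
      (\<lambda>h. ?B \<theta> (dQ h y) + frechet_derivative (\<lambda>u. ?B u (Q \<theta> y)) (at \<theta>) h)) (at \<theta>)"
    by (rule has_derivative_linear_family[where B = ?B, OF S(1,2) lin
          smooth_on_imp_has_derivative[OF smooth_on_frechet_derivative[OF S(4)] S(1,2)] dQ_has_derivative])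
  then have "((\<lambda>u. ?h (\<xi> u)) has_derivative
      (\<lambda>h. ?B \<theta> (dQ h y) + frechet_derivative (\<lambda>u. ?B u (Q \<theta> y)) (at \<theta>) h)) (at \<theta>)"
    by (rule has_derivative_transform_within_open[OF _ S(1,2)]) (rule eq)
  from chart_vector_eqI[OF atlas chart e_in_chart sm this, of x] f show ?thesis
    by (simp add: chart_vector_def)
qed

text \<open>After the second-order terms cancel, \<open>dQ x y - dQ y x\<close> remains, and
  \<open>dP_swap\<close> turns it into \<open>dQ x y - dP x y\<close>.\<close>

lemma lie_bracket_chart: "lie_bracket G A (tv x) (tv y) = tv (dC x y)"
proof
  fix f
  show "lie_bracket G A (tv x) (tv y) f = tv (dC x y) f"
  proof (cases "smooth_at A e f")
    case True
    have e: "left_invariant_field G A (tv w) e = tv w" for w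
      by (rule left_invariant_field_e) (simp add: lie_algebra_eq)
    obtain S where S: "open S" "\<theta> \<in> S" "smooth_on S (\<lambda>x. f (\<xi> x))"
      using True smooth_at_iff[OF atlas chart e_in_chart] by blast
    have "lie_bracket G A (tv x) (tv y) f = tv (dQ x y) f - tv (dQ y x) f"
      using True second_derivative_symmetric[OF S, of x y]
      by (simp add: lie_bracket_def vf_bracket_def e left_invariant_field_derivative)
    also have "\<dots> = tv (dC x y) f"
      by (simp add: dC_eq dP_swap linear_diff[OF linear_tv])
    finally show ?thesis .
  qed (simp add: lie_bracket_def vf_bracket_def chart_vector_def)
qed

lemma differential_conjugation:
  assumes "u \<in> I"
  shows "differential A (conjugation (\<xi> u)) e (tv w) = tv (C u w)"
  using differential_chart[OF atlas smooth_map_conjugation chart e_in_chart, of "\<xi> u" "C u" w]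
    C_has_derivative[OF assms] e_in_chart
  by (simp add: K_def)

text \<open>\<open>\<mu> (u, \<phi> (rec (\<xi> u)))\<close> is constantly \<open>\<theta>\<close>
  on \<open>I\<close>, and the derivative of \<open>\<mu>\<close> at
  \<open>(\<theta>, \<theta>)\<close> is addition; hence \<open>w\<close> and its image sum to
  0.\<close>

lemma differential_rec: "differential A rec e (tv w) = tv (- w)"
proof -
  let ?i = "\<lambda>u. \<phi> (rec (\<xi> u))"
  let ?D = "frechet_derivative ?i (at \<theta>)"
  have D: "(?i has_derivative ?D) (at \<theta>)"
    by (rule smooth_on_imp_has_derivative[OF smooth_\<iota> open_I o_in_I])
  have oo: "(\<theta>, \<theta>) \<in> M" by (simp add: in_M_left)
  interpret linear "frechet_derivative \<mu> (at (\<theta>, \<theta>))"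
    by (rule smooth_on_imp_linear[OF smooth_\<mu> open_M oo])
  have \<mu>': "frechet_derivative \<mu> (at (\<theta>, \<theta>)) (a, b) = a + b" for a b
    using add[of "(a, 0)" "(0, b)"] P_o[of a] Q_o[of b] by (simp add: P_def Q_def)
  have "(\<mu> has_derivative frechet_derivative \<mu> (at (\<theta>, \<theta>))) (at (\<theta>, ?i \<theta>))"
    using smooth_on_imp_has_derivative[OF smooth_\<mu> open_M oo] by simp
  from has_derivative_compose[OF has_derivative_Pair[OF has_derivative_ident D] this]
  have "((\<lambda>u. \<mu> (u, ?i u)) has_derivative (\<lambda>w. w + ?D w)) (at \<theta>)"
    by (simp add: \<mu>')
  then have "((\<lambda>u. \<theta>) has_derivative (\<lambda>w. w + ?D w)) (at \<theta>)"
    by (rule has_derivative_transform_within_open[OF _ open_I o_in_I]) (auto simp: I_def \<mu>_def)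
  from has_derivative_unique[OF this has_derivative_const]
  have "?D w = - w" by (simp add: fun_eq_iff eq_neg_iff_add_eq_0 add.commute)
  then show ?thesis
    using differential_chart[OF atlas smooth_rec chart e_in_chart _ D, of w] e_in_chart by simp
qed

end


section \<open>Bi-invariant metrics on 2-step nilpotent groups\<close>

text \<open>A functional \<open>\<lambda>y. y \<bullet> b\<close> that vanishes on \<open>T\<close>
  vanishes along \<open>f\<close> near \<open>x\<close>, hence on the derivative. So
  \<open>f' h\<close> lies in the double orthogonal complement of \<open>T\<close>, which is
  \<open>T\<close>.\<close>

lemma derivative_in_subspace:
  fixes f :: "'a::euclidean_space \<Rightarrow> 'b::euclidean_space"
  assumes "(f has_derivative f') (at x)" "open S" "x \<in> S" "subspace T" "\<And>u. u \<in> S \<Longrightarrow> f u \<in> T"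
  shows "f' h \<in> T"
proof -
  have "f' h \<bullet> b = 0" if b: "\<And>y. y \<in> T \<Longrightarrow> y \<bullet> b = 0" for b
  proof -
    have "((\<lambda>u. f u \<bullet> b) has_derivative (\<lambda>h. f' h \<bullet> b)) (at x)"
      by (rule bounded_linear.has_derivative[OF bounded_linear_inner_left assms(1)])
    then have "((\<lambda>u. 0) has_derivative (\<lambda>h. f' h \<bullet> b)) (at x)"
      by (rule has_derivative_transform_within_open[OF _ assms(2,3)]) (simp add: assms(5) b)
    from has_derivative_unique[OF this has_derivative_const] show ?thesis by (simp add: fun_eq_iff)
  qed
  then have "f' h \<in> orthogonal_comp (orthogonal_comp T)"
    by (auto simp: orthogonal_comp_def orthogonal_def inner_commute)
  then show ?thesis by (simp add: orthogonal_comp_self assms(4))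
qed

section \<open>Center and nilpotency in coordinates\<close>

context lie_group_chart
begin

lemma tv_eq_0_iff: "tv w = 0 \<longleftrightarrow> w = 0"
  using inj_tv linear_0[OF linear_tv] by (metis injD)

text \<open>Antisymmetry moves the central vector from the first slot of the bracket to the second,
  the one on which the derivative of \<open>Ad\<close> acts.\<close>

lemma lie_center_chart: "lie_center G A = tv ` {z. \<forall>h. dC h z = 0}"
proof -
  have "dC z h = 0 \<longleftrightarrow> dC h z = 0" for z h using dC_antisym[of z h] by simp
  then show ?thesis by (auto simp: lie_center_def lie_algebra_eq lie_bracket_chart tv_eq_0_iff)
qed

lemma two_step_nilpotent_chart:
  assumes "two_step_nilpotent G A"
  shows "\<And>h x. tv (dC h x) \<in> lie_center G A" and "\<exists>h x. dC h x \<noteq> 0"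
proof -
  from assms have 1: "lie_bracket G A (lie_bracket G A (tv x) (tv y)) (tv z) = 0" for x y z
    by (simp add: two_step_nilpotent_def lie_algebra_eq)
  then show "tv (dC h x) \<in> lie_center G A" for h x
    by (simp add: lie_center_def lie_algebra_eq lie_bracket_chart)
  from assms show "\<exists>h x. dC h x \<noteq> 0"
    by (auto simp: two_step_nilpotent_def lie_algebra_eq lie_bracket_chart tv_eq_0_iff)
qed

text \<open>All conjugations are trivial, so \<open>C u\<close> is the identity for every
  \<open>u\<close> in \<open>I\<close> and its derivative vanishes. This is the contradiction
  reached if inversion is an automorphism.\<close>

lemma abelian_imp_dC_zero:
  assumes "\<And>x y. x \<cdot> y = y \<cdot> x"
  shows "dC h w = 0"
proof -
  have "conjugation a = (\<lambda>x. x)" for a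
    using assms[of a] by (simp add: fun_eq_iff conjugation_def mul_assoc)
  then have "tv (C u w) = tv w" if "u \<in> I" for u
    using differential_conjugation[OF that, of w] differential_id[of "tv w" A e] lie_algebra_eq
    by (simp add: lie_algebra_def)
  then have "C u w = w" if "u \<in> I" for u
    using inj_tv that by (meson injD)
  then have "((\<lambda>u. w) has_derivative (\<lambda>h. dC h w)) (at \<theta>)"
    by (intro has_derivative_transform_within_open[OF dC_has_derivative open_I o_in_I])
  from has_derivative_unique[OF this has_derivative_const] show ?thesis by (simp add: fun_eq_iff)
qed

end

section \<open>Bi-invariant metrics\<close>

locale bi_invariant_lie_group = lie_group_atlas G A
  for G :: "'n::{t2_space,second_countable_topology} monoid"
    and A :: "('n, 'e::euclidean_space) atlas" +
  fixes g :: "'n metric_tensor"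
  assumes metric: "pseudo_riemannian_metric A g" and bi_invariant: "bi_invariant G A g"
begin

lemma left_translation_Iso: "left_translation G a \<in> Iso A g"
  and right_translation_Iso: "right_translation G a \<in> Iso A g"
  using bi_invariant by (simp_all add: bi_invariant_def)

lemma conjugation_Iso: "conjugation a \<in> Iso A g"
  unfolding conjugation_eq
  by (rule Iso_compose[OF atlas left_translation_Iso right_translation_Iso])

lemma metric_sym:
  "X \<in> tangent_space A p \<Longrightarrow> Y \<in> tangent_space A p \<Longrightarrow> g p X Y = g p Y X"
  using metric by (simp add: pseudo_riemannian_metric_def)

lemma metric_linear:
  "X \<in> tangent_space A p \<Longrightarrow> Y \<in> tangent_space A p \<Longrightarrow> Z \<in> tangent_space A p \<Longrightarrow>
    g p (a *\<^sub>R X + b *\<^sub>R Y) Z = a * g p X Z + b * g p Y Z"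
  using metric by (simp add: pseudo_riemannian_metric_def)

end

section \<open>The invariant form at the identity and the degenerate center\<close>

locale bi_invariant_chart = lie_group_chart G A U \<phi> + bi_invariant_lie_group G A g
  for G :: "'n::{t2_space,second_countable_topology} monoid"
    and A :: "('n, 'e::euclidean_space) atlas" and U \<phi> g
begin

definition \<gamma> :: "'e \<Rightarrow> 'e \<Rightarrow> real" where "\<gamma> x y = g e (tv x) (tv y)"

lemma tv_tangent: "tv w \<in> tangent_space A e"
  using lie_algebra_eq by (auto simp: lie_algebra_def)

lemma \<gamma>_sym: "\<gamma> x y = \<gamma> y x"
  using metric_sym[OF tv_tangent tv_tangent] by (simp add: \<gamma>_def)

lemma \<gamma>_linear: "\<gamma> (a *\<^sub>R x + b *\<^sub>R y) z = a * \<gamma> x z + b * \<gamma> y z"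
  using metric_linear[OF tv_tangent tv_tangent tv_tangent]
  by (simp add: \<gamma>_def linear_add[OF linear_tv] linear_scale[OF linear_tv])

text \<open>Linearity is given in the first argument and symmetry transfers it to the second.
  Boundedness is automatic in finite dimension and gives the product rule for
  \<open>\<gamma> (C u x) (C u z)\<close>.\<close>

lemma bounded_bilinear_\<gamma>: "bounded_bilinear \<gamma>"
proof -
  \<comment> \<open>The two-term law yields additivity with both coefficients 1 and homogeneity with
    the second coefficient 0.\<close>
  have "linear (\<lambda>x. \<gamma> x z)" for z
    using \<gamma>_linear[of 1 _ 1 _ z] \<gamma>_linear[of _ _ 0 0 z] by (intro linearI) auto
  moreover from this have "linear (\<gamma> z)" for z
    by (subst \<gamma>_sym[abs_def])
  ultimately show ?thesis
    by (simp add: bilinear_conv_bounded_bilinear[symmetric] bilinear_def)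
qed

text \<open>The infinitesimal form of the \<open>Ad\<close>-invariance of the metric.\<close>

lemma \<gamma>_dC: "\<gamma> x (dC h z) + \<gamma> (dC h x) z = 0"
proof -
  have inv: "\<gamma> (C u x) (C u z) = \<gamma> x z" if "u \<in> I" for u
    using IsoD_metric[OF conjugation_Iso tv_tangent tv_tangent, of "\<xi> u" x z] that
    by (simp add: \<gamma>_def differential_conjugation)
  have "((\<lambda>u. \<gamma> (C u x) (C u z)) has_derivative
      (\<lambda>h. \<gamma> (C \<theta> x) (dC h z) + \<gamma> (dC h x) (C \<theta> z))) (at \<theta>)"
    by (rule bounded_bilinear.FDERIV[OF bounded_bilinear_\<gamma> dC_has_derivative dC_has_derivative])
  then have "((\<lambda>u. \<gamma> x z) has_derivative
      (\<lambda>h. \<gamma> (C \<theta> x) (dC h z) + \<gamma> (dC h x) (C \<theta> z))) (at \<theta>)"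
    by (rule has_derivative_transform_within_open[OF _ open_I o_in_I]) (rule inv)
  from has_derivative_unique[OF this has_derivative_const] show ?thesis by (simp add: fun_eq_iff)
qed

lemma degenerate_center:
  assumes "two_step_nilpotent G A"
  shows "degenerate_on (lie_center G A) (g e)"
proof -
  obtain h x where hx: "dC h x \<noteq> 0" using two_step_nilpotent_chart(2)[OF assms] by blast
  have "g e (tv (dC h x)) Y = 0" if "Y \<in> lie_center G A" for Y
  proof -
    have "\<exists>z. Y = tv z \<and> dC h z = 0" using that by (auto simp: lie_center_chart)
    then obtain z where "Y = tv z" "dC h z = 0" by blast
    then show ?thesis
      using \<gamma>_dC[of x h z] bounded_bilinear.zero_right[OF bounded_bilinear_\<gamma>] by (simp add: \<gamma>_def)
  qed
  then show ?thesis
    unfolding degenerate_on_def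
    using two_step_nilpotent_chart(1)[OF assms] hx tv_eq_0_iff by blast
qed

section \<open>Right translations and the splitting\<close>

lemma conjugation_preserves_complement:
  assumes "\<And>a. right_translation G a \<in> Iso_spl G A g V" "V \<subseteq> lie_algebra G A" "X \<in> V"
  shows "differential A (conjugation a) e X \<in> V"
proof -
  \<comment> \<open>The factors stand in the opposite order to \<open>conjugation_eq\<close>: the
    left translation acts first and carries \<open>V\<close> to the distribution at
    \<open>a\<close>, then the right translation brings that distribution back to the
    identity.\<close>
  have "conjugation a = right_translation G (rec a) \<circ> left_translation G a"
    by (simp add: fun_eq_iff conjugation_def left_translation_def right_translation_def)
  then have "differential A (conjugation a) e X =
      differential A (right_translation G (rec a)) a (left_invariant_field G A X a)"
    using differential_compose[OF atlas smooth_map_right_translation, of "rec a" "left_translation G a" e X]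
    by (simp add: left_invariant_field_def left_translation_def)
  also have "\<dots> \<in> differential A (right_translation G (rec a)) a ` left_distribution G A V a"
    using assms(3) by (simp add: left_distribution_def)
  also have "\<dots> = left_distribution G A V e"
    using assms(1)[of "rec a"]
    by (simp add: Iso_spl_def preserves_distribution_def right_translation_def)
  also have "\<dots> = V"
    using assms(2) left_invariant_field_e by (force simp: left_distribution_def)
  finally show ?thesis .
qed

lemma right_translation_not_splitting:
  assumes "two_step_nilpotent G A" and V: "direct_sum_decomp (lie_algebra G A) V (lie_center G A)"
  shows "\<exists>a. right_translation G a \<notin> Iso_spl G A g V"
proof (rule ccontr)
  assume "\<not> ?thesis"
  then have spl: "\<And>a. right_translation G a \<in> Iso_spl G A g V" by blast
  have sub: "subspace V" and Z: "subspace (lie_center G A)" and int: "V \<inter> lie_center G A = {0}"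
    and sum: "lie_algebra G A = {X + Y |X Y. X \<in> V \<and> Y \<in> lie_center G A}"
    using V by (auto simp: direct_sum_decomp_def)
  have VL: "V \<subseteq> lie_algebra G A"
  proof
    fix X assume "X \<in> V"
    then show "X \<in> lie_algebra G A"
      unfolding sum using subspace_0[OF Z] by (intro CollectI exI[of _ X] exI[of _ 0]) simp
  qed
  \<comment> \<open>\<open>derivative_in_subspace\<close> works in a Euclidean space, so
    \<open>V\<close> is pulled back to coordinates.\<close>
  have sub': "subspace (tv -` V)" by (rule linear_subspace_vimage[OF linear_tv sub])
  have "dC h w = 0" if w: "tv w \<in> V" for h w
  proof -
    have "C u w \<in> tv -` V" if "u \<in> I" for u
      using conjugation_preserves_complement[OF spl VL w, of "\<xi> u"] that
      by (simp add: differential_conjugation)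
    \<comment> \<open>\<open>C u w\<close> stays in the pulled-back subspace for all
      \<open>u\<close> in \<open>I\<close>, hence so does its derivative. The same vector is a
      bracket and therefore central.\<close>
    from derivative_in_subspace[OF dC_has_derivative open_I o_in_I sub' this]
    have "tv (dC h w) \<in> V" by simp
    then have "tv (dC h w) = 0"
      using int two_step_nilpotent_chart(1)[OF assms(1), of h w] by blast
    then show ?thesis by (simp add: tv_eq_0_iff)
  qed
  \<comment> \<open>Vanishing of \<open>dC h w\<close> for all \<open>h\<close> makes
    \<open>tv w\<close> central. A complement contained in the center leaves no room for a
    noncentral vector.\<close>
  then have "V \<subseteq> lie_center G A"
    using VL by (auto simp: lie_center_chart lie_algebra_eq)
  then have "lie_algebra G A \<subseteq> lie_center G A"
    using subspace_add[OF Z] by (auto simp: sum)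
  then have "tv w \<in> lie_center G A" for w by (auto simp: lie_algebra_eq)
  then have "dC h w = 0" for h w
    by (auto simp: lie_center_chart inj_image_mem_iff[OF inj_tv])
  then show False using two_step_nilpotent_chart(2)[OF assms(1)] by blast
qed

section \<open>Inversion\<close>

lemma rec_Iso: "rec \<in> Iso A g"
proof -
  have "bij rec" by (rule involuntory_imp_bij) simp
  moreover have "inv_into UNIV rec = rec"
    using bij_is_inj[OF \<open>bij rec\<close>] by (intro ext inv_f_eq) simp_all
  ultimately have "diffeomorphism A rec" by (simp add: diffeomorphism_def smooth_rec)
  moreover have "g (rec p) (differential A rec p X) (differential A rec p Y) = g p X Y"
    if X: "X \<in> tangent_space A p" and Y: "Y \<in> tangent_space A p" for p X Y
  proof -
    \<comment> \<open>The vector \<open>w\<close> is \<open>X\<close> moved back to the identity.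
      Since \<open>(p x)^-1 = x^-1 p^-1\<close>, inversion near \<open>p\<close> is inversion near
      the identity followed by a right translation, so the same \<open>w\<close> describes the image
      up to sign.\<close>
    have lift: "\<exists>w. X = differential A (left_translation G p) e (tv w) \<and>
        differential A rec p X = differential A (right_translation G (rec p)) e (tv (- w))"
      if X: "X \<in> tangent_space A p" for X
    proof -
      have "differential A (left_translation G (rec p)) p X \<in> tangent_space A e"
        using differential_in_tangent_space[OF atlas smooth_map_left_translation X, of "rec p"]
        by (simp add: left_translation_def)
      then obtain w where w: "tv w = differential A (left_translation G (rec p)) p X"
        using lie_algebra_eq by (auto simp: lie_algebra_def)
      have "left_translation G p \<circ> left_translation G (rec p) = (\<lambda>x. x)"
        by (simp add: fun_eq_iff left_translation_def)
      then have 1: "X = differential A (left_translation G p) e (tv w)"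
        using differential_compose[OF atlas smooth_map_left_translation, of p "left_translation G (rec p)" p X]
          differential_id[OF X]
        by (simp add: w left_translation_def)
      have "rec \<circ> left_translation G p = right_translation G (rec p) \<circ> rec"
        by (simp add: fun_eq_iff left_translation_def right_translation_def rec_distrib)
      moreover have "left_translation G p e = p" by (simp add: left_translation_def)
      ultimately have "differential A rec p X = differential A (right_translation G (rec p)) e (tv (- w))"
        using differential_compose[OF atlas smooth_rec, of "left_translation G p" e "tv w"]
          differential_compose[OF atlas smooth_map_right_translation, of "rec p" rec e "tv w"]
        by (simp add: 1[symmetric] differential_rec)
      with 1 show ?thesis by blast
    qed
    obtain x y where
      x: "X = differential A (left_translation G p) e (tv x)"
        "differential A rec p X = differential A (right_translation G (rec p)) e (tv (- x))" and
      y: "Y = differential A (left_translation G p) e (tv y)"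
        "differential A rec p Y = differential A (right_translation G (rec p)) e (tv (- y))"
      using lift[OF X] lift[OF Y] by blast
    have "g (rec p) (differential A rec p X) (differential A rec p Y) = \<gamma> (- x) (- y)"
      using IsoD_metric[OF right_translation_Iso tv_tangent tv_tangent, of "rec p" "- x" "- y"]
      by (simp add: x(2) y(2) \<gamma>_def right_translation_def)
    also have "\<dots> = \<gamma> x y"
      by (simp add: bounded_bilinear.minus_left[OF bounded_bilinear_\<gamma>]
          bounded_bilinear.minus_right[OF bounded_bilinear_\<gamma>])
    also have "\<dots> = g p X Y"
      using IsoD_metric[OF left_translation_Iso tv_tangent tv_tangent, of p x y]
      by (simp add: x(1) y(1) \<gamma>_def left_translation_def)
    finally show ?thesis .
  qed
  ultimately show ?thesis by (simp add: Iso_def)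
qed

text \<open>Both inversion and an automorphism fix the identity, which forces the translation part
  to be trivial; inversion would then itself be a homomorphism.\<close>

lemma rec_not_Iso_aut:
  assumes "two_step_nilpotent G A"
  shows "rec \<notin> Iso_aut G A g"
proof
  interpret gr: group G by (rule group)
  assume "rec \<in> Iso_aut G A g"
  then obtain n \<psi> where n: "rec = left_translation G n \<circ> \<psi>" and \<psi>: "\<psi> \<in> iso G G"
    by (auto simp: Iso_aut_def isometric_automorphisms_def)
  have hom: "\<psi> \<in> hom G G" using \<psi> by (simp add: iso_def)
  have "\<psi> e = e" by (rule hom_one[OF hom gr.is_group gr.is_group])
  then have "n = e" using fun_cong[OF n, of e] by (simp add: left_translation_def)
  then have "rec = \<psi>" by (simp add: n fun_eq_iff left_translation_def)
  then have "rec (x \<cdot> y) = rec x \<cdot> rec y" for x y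
    using hom by (simp add: hom_mult carrier)
  \<comment> \<open>Inverting both sides of the homomorphism law: the left becomes
    \<open>y \<cdot> x\<close>, the right \<open>x \<cdot> y\<close>.\<close>
  then have "rec (rec x \<cdot> rec y) = rec (rec (x \<cdot> y))" for x y by simp
  then have "x \<cdot> y = y \<cdot> x" for x y by (simp add: rec_distrib)
  from abelian_imp_dC_zero[OF this] show False
    using two_step_nilpotent_chart(2)[OF assms] by blast
qed

lemma right_translation_Iso_aut: "right_translation G a \<in> Iso_aut G A g"
proof -
  let ?c = "conjugation (rec a)"
  have "bij ?c"
    by (rule o_bij[of "conjugation a"]) (auto simp: fun_eq_iff conjugation_def mul_assoc)
  then have "?c \<in> iso G G"
    using lie_group
    by (auto simp: iso_def hom_def lie_group_def conjugation_def mul_assoc)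
  then have "?c \<in> isometric_automorphisms G A g"
    by (simp add: isometric_automorphisms_def conjugation_Iso)
  moreover have "right_translation G a = left_translation G a \<circ> ?c"
    by (simp add: fun_eq_iff right_translation_def left_translation_def conjugation_def mul_assoc)
  ultimately show ?thesis by (auto simp: Iso_aut_def)
qed

lemma Iso_aut_subset: "Iso_aut G A g \<subseteq> Iso A g"
  using Iso_compose[OF atlas left_translation_Iso]
  by (auto simp: Iso_aut_def isometric_automorphisms_def)

end

theorem proposition5p3:
  fixes G :: "'n::{t2_space,second_countable_topology} monoid"
    and A :: "('n, 'e::euclidean_space) atlas"
    and g :: "'n metric_tensor"
    and V :: "'n tangent_vector set"
  assumes "lie_group G A"
    and "simply_connected (UNIV :: 'n set)"
    and "two_step_nilpotent G A"
    and "pseudo_riemannian_metric A g"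
    and "bi_invariant G A g"
    and "direct_sum_decomp (lie_algebra G A) V (lie_center G A)"
  shows "degenerate_on (lie_center G A) (g \<one>\<^bsub>G\<^esub>) \<and>
    Iso_spl G A g V \<noteq> Iso_aut G A g \<and>
    Iso_spl G A g V \<subset> Iso A g \<and>
    Iso_aut G A g \<subset> Iso A g"
proof -
  have "smooth_atlas A" using assms(1) by (simp add: lie_group_def)
  \<comment> \<open>The conclusion mentions no chart, so any chart around the identity may be
    fixed.\<close>
  then obtain U \<phi> where U: "(U, \<phi>) \<in> A" "\<one>\<^bsub>G\<^esub> \<in> U" using chart_exists by blast
  interpret bi_invariant_chart G A U \<phi> g
    by unfold_locales (use assms U in auto)
  obtain a where a: "right_translation G a \<notin> Iso_spl G A g V"
    using right_translation_not_splitting[OF assms(3,6)] by blast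
  have "Iso_spl G A g V \<subseteq> Iso A g" by (auto simp: Iso_spl_def)
  \<comment> \<open>\<open>right_translation G a\<close> lies in \<open>Iso_aut\<close> but not in
    \<open>Iso_spl\<close>, which separates \<open>Iso_spl\<close> from both \<open>Iso_aut\<close>
    and \<open>Iso\<close>; inversion separates \<open>Iso_aut\<close> from
    \<open>Iso\<close>.\<close>
  then show ?thesis
    using degenerate_center[OF assms(3)] a right_translation_Iso right_translation_Iso_aut
      Iso_aut_subset rec_Iso rec_not_Iso_aut[OF assms(3)]
    by blast
qed

end
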